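(* Consider the generalised ant with rule word $w = LLRLRLL$ (so $|w|=7$). Then there exists a finite configuration from which this ant has a cone behaviour, and there exist infinitely many pairwise inequivalent diagonal highways of this ant, each of which the ant is in from some finite configuration.
   Context: Let $Q=\{(0,1),(1,0),(0,-1),(-1,0)\}$ be the set of directions, with counterclockwise rotation $t^{\circlearrowleft}$ and clockwise rotation $t^{\circlearrowright}$ (rotations by $\pm 90^\circ$). For a word $w\in\{L,R\}^*$, an ant configuration is a triple $(c,(i,j),q)$ with $c\in\{0,\dots,|w|-1\}^{\mathbb{Z}^2}$, $(i,j)\in\mathbb{Z}^2$, $q\in Q$. The generalised ant $T_w$ maps $(c,(i,j),q)$ to $(c',(i',j'),q')$ where, with $k=c_{i,j}$: $q'=t^{\circlearrowright}(q)$ if $w_k=R$ and $q'=t^{\circlearrowleft}(q)$ if $w_k=L$; $(i',j')=(i,j)+q'$; $c'_{i,j}=c_{i,j}+1 \bmod |w|$; $c'_{k,l}=c_{k,l}$ for $(k,l)\ne(i,j)$. A configuration is finite if $c$ has only finitely many nonzero cells. The trace from $C$ is the sequence of cell states read by the ant at successive steps and the trajectory is the sequence $(\mathbf{y}_n)_{n\in\mathbb{N}}$ of its positions. Highway: the ant is in a highway of period $n$ and drift $(a,b)$ from $C$ if $C$ is finite, the trace $x$ satisfies $x_{i+n}=x_i$ for all $i$ (with $n$ minimal), and the trajectory satisfies $\mathbf{y}_{i+n}=\mathbf{y}_i+(a,b)$ for all $i$. Two highways are equivalent if their traces and trajectories coincide after removing a finite prefix from both. A highway is diagonal if its drift is a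 multiple of $(\pm1,\pm1)$. Interlaced word: $x\in\mathcal{A}^{\mathbb{N}}$ is interlaced if there exist $k\ge 1$ and words $u_i,v_i\in\mathcal{A}^*$ ($0\le i<k$) with $x=t_0t_1t_2\cdots$ where $t_n=u_0v_0^n u_1 v_1^n\cdots u_{k-1}v_{k-1}^n$. Previsible trajectory: for a compact $\Delta\subset\mathbb{R}^2$ containing $0$, a trajectory $\mathbf{y}$ is $\Delta$-previsible if there exist non-decreasing $f,g:\mathbb{N}\to\mathbb{R}^+$, an integer $k$ and a nonzero vector $\vec d\in\mathbb{R}^2$ such that (i) for all $n$, $\mathbf{y}_n\in\partial_k(f(n)\Delta+g(n)\vec d)$, and (ii) for every $p\in\partial\Delta$ and every $N$ there is $n\ge N$ with $d(\mathbf{y}_n, f(n)p+g(n)\vec d)\le k$. Here $f(n)X+g(n)\vec d$ is the dilation of $X$ by $f(n)$ about $0$ translated by $g(n)\vec d$, $\partial X$ is the boundary and $\partial_k X$ the set of points at distance at most $k$ from $\partial X$. The behaviour is increasing if $f(n)\to+\infty$ and drifting if $g(n)\to+\infty$. Emergent behaviour from $C$: the trace is eventually interlaced and the trajectory is $\Delta$-previsible for some compact $\Delta$. Cone behaviour: a drifting and increasing emergent behaviour whose functions satisfy $g=\Theta(f)$. *)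

theory Defs
  imports "HOL-Analysis.Analysis" "HOL-Library.Landau_Symbols"
begin

datatype turn = L | R

type_synonym cell = "int \<times> int"
type_synonym dir = "int \<times> int"
type_synonym ant_conf = "(cell \<Rightarrow> nat) \<times> cell \<times> dir"

definition dirs :: "dir set" where
  "dirs = {(0,1), (1,0), (0,-1), (-1,0)}"

definition rot_cw :: "dir \<Rightarrow> dir" where
  "rot_cw q = (snd q, - fst q)"

definition rot_ccw :: "dir \<Rightarrow> dir" where
  "rot_ccw q = (- snd q, fst q)"

definition ant_step :: "turn list \<Rightarrow> ant_conf \<Rightarrow> ant_conf" where
  "ant_step w C = (case C of (c, p, q) \<Rightarrow>
     (let k = c p;
          q' = (if w ! k = R then rot_cw q else rot_ccw q)
      in (c(p := (c p + 1) mod length w), (fst p + fst q', snd p + snd q'), q')))"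

definition finite_config :: "turn list \<Rightarrow> ant_conf \<Rightarrow> bool" where
  "finite_config w C \<longleftrightarrow>
     (case C of (c, p, q) \<Rightarrow> (\<forall>x. c x < length w) \<and> q \<in> dirs \<and> finite {x. c x \<noteq> 0})"

definition ant_trace :: "turn list \<Rightarrow> ant_conf \<Rightarrow> nat \<Rightarrow> nat" where
  "ant_trace w C n = (case (ant_step w ^^ n) C of (c, p, q) \<Rightarrow> c p)"

definition ant_traj :: "turn list \<Rightarrow> ant_conf \<Rightarrow> nat \<Rightarrow> cell" where
  "ant_traj w C n = fst (snd ((ant_step w ^^ n) C))"

definition highway_cond :: "turn list \<Rightarrow> ant_conf \<Rightarrow> nat \<Rightarrow> int \<Rightarrow> int \<Rightarrow> bool" where
  "highway_cond w C n a b \<longleftrightarrow>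
     (\<forall>i. ant_trace w C (i + n) = ant_trace w C i) \<and>
     (\<forall>i. ant_traj w C (i + n) = (fst (ant_traj w C i) + a, snd (ant_traj w C i) + b))"

definition in_highway :: "turn list \<Rightarrow> ant_conf \<Rightarrow> nat \<Rightarrow> int \<Rightarrow> int \<Rightarrow> bool" where
  "in_highway w C n a b \<longleftrightarrow>
     finite_config w C \<and> 0 < n \<and> highway_cond w C n a b \<and>
     (\<forall>m a' b'. 0 < m \<and> m < n \<longrightarrow> \<not> highway_cond w C m a' b')"

definition diagonal_highway_from :: "turn list \<Rightarrow> ant_conf \<Rightarrow> bool" where
  "diagonal_highway_from w C \<longleftrightarrow>
     (\<exists>n a b. in_highway w C n a b \<and> \<bar>a\<bar> = \<bar>b\<bar>)"

definition highway_equiv :: "turn list \<Rightarrow> ant_conf \<Rightarrow> ant_conf \<Rightarrow> bool" where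
  "highway_equiv w C C' \<longleftrightarrow>
     (\<exists>k1 k2 v1 v2. \<forall>i.
        ant_trace w C (k1 + i) = ant_trace w C' (k2 + i) \<and>
        ant_traj w C (k1 + i) = (fst (ant_traj w C' (k2 + i)) + v1, snd (ant_traj w C' (k2 + i)) + v2))"

definition interlace_block :: "nat \<Rightarrow> (nat \<Rightarrow> 'a list) \<Rightarrow> (nat \<Rightarrow> 'a list) \<Rightarrow> nat \<Rightarrow> 'a list" where
  "interlace_block k u v n = concat (map (\<lambda>i. u i @ concat (replicate n (v i))) [0..<k])"

definition inf_concat :: "(nat \<Rightarrow> 'a list) \<Rightarrow> (nat \<Rightarrow> 'a) \<Rightarrow> bool" where
  "inf_concat t x \<longleftrightarrow>
     (\<forall>n. \<exists>m\<ge>n. t m \<noteq> []) \<and>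
     (\<forall>m j. j < length (t m) \<longrightarrow> x ((\<Sum>l<m. length (t l)) + j) = t m ! j)"

definition interlaced :: "(nat \<Rightarrow> 'a) \<Rightarrow> bool" where
  "interlaced x \<longleftrightarrow>
     (\<exists>k::nat. k \<ge> 1 \<and> (\<exists>u v. inf_concat (interlace_block k u v) x))"

definition eventually_interlaced :: "(nat \<Rightarrow> 'a) \<Rightarrow> bool" where
  "eventually_interlaced x \<longleftrightarrow> (\<exists>N. interlaced (\<lambda>i. x (N + i)))"

definition to_real2 :: "int \<times> int \<Rightarrow> real \<times> real" where
  "to_real2 p = (real_of_int (fst p), real_of_int (snd p))"

definition dil_trans :: "real \<Rightarrow> real \<Rightarrow> real \<times> real \<Rightarrow> (real \<times> real) set \<Rightarrow> (real \<times> real) set" where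
  "dil_trans s t d X = (\<lambda>p. s *\<^sub>R p + t *\<^sub>R d) ` X"

definition bdry_nbhd :: "real \<Rightarrow> (real \<times> real) set \<Rightarrow> (real \<times> real) set" where
  "bdry_nbhd k X = {p. \<exists>q\<in>frontier X. dist p q \<le> k}"

definition previsible_with ::
  "(real \<times> real) set \<Rightarrow> (nat \<Rightarrow> real \<times> real) \<Rightarrow> (nat \<Rightarrow> real) \<Rightarrow> (nat \<Rightarrow> real) \<Rightarrow> int \<Rightarrow> real \<times> real \<Rightarrow> bool" where
  "previsible_with \<Delta> y f g k d \<longleftrightarrow>
     mono f \<and> mono g \<and> (\<forall>n. f n \<ge> 0 \<and> g n \<ge> 0) \<and> d \<noteq> 0 \<and>
     (\<forall>n. y n \<in> bdry_nbhd (real_of_int k) (dil_trans (f n) (g n) d \<Delta>)) \<and>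
     (\<forall>p\<in>frontier \<Delta>. \<forall>N. \<exists>n\<ge>N. dist (y n) (f n *\<^sub>R p + g n *\<^sub>R d) \<le> real_of_int k)"

definition cone_behaviour_from :: "turn list \<Rightarrow> ant_conf \<Rightarrow> bool" where
  "cone_behaviour_from w C \<longleftrightarrow>
     eventually_interlaced (ant_trace w C) \<and>
     (\<exists>\<Delta> f g k d. compact \<Delta> \<and> (0::real \<times> real) \<in> \<Delta> \<and>
        previsible_with \<Delta> (\<lambda>n. to_real2 (ant_traj w C n)) f g k d \<and>
        filterlim f at_top sequentially \<and> filterlim g at_top sequentially \<and>
        g \<in> \<Theta>(f))"

end

theory Submission
  imports Defs "HOL-Library.AList"
begin

text \<open>
The ant sweeps back and forth along a horizontal front made of a left end, \<open>m\<close> copies of a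
two-column unit and a right end; all cells above the front or far to its left are \<open>0\<close>. Passing a
unit only affects that unit and its neighbour, so a finite computation that does not depend on
\<open>m\<close> determines what a lap (one sweep forth and back) does to the ends and to the units. After two
laps the left end and the units reappear translated by \<open>(-2, 2)\<close>.

For one particular right end, this end reappears as well, with the same \<open>m\<close>. This gives for every
\<open>m\<close> a highway of drift \<open>(-2, 2)\<close> whose period is a strictly increasing affine function of \<open>m\<close>;
these highways have different speeds and hence are inequivalent.

Three other right ends turn into each other cyclically while \<open>m\<close> grows by \<open>2\<close>. The front is then a
segment which after \<open>n\<close> such cycles reaches from about \<open>n (-6, 6)\<close> to about \<open>n (-2, 6)\<close> and is
swept completely in each cycle: a cone behaviour for the segment \<open>\<Delta>\<close> from \<open>0\<close> to \<open>(4, 0)\<close> and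
the direction \<open>(-6, 6)\<close>.
\<close>

section \<open>Simulation on finite patches\<close>

type_synonym patch = "(cell \<times> nat) list"
type_synonym strip = "patch \<times> patch \<times> patch \<times> patch \<times> cell \<times> dir"
type_synonym lap_words = "nat list \<times> nat list \<times> nat list \<times> nat list"

definition turned :: "turn list \<Rightarrow> nat \<Rightarrow> dir \<Rightarrow> dir" where
  "turned w k q = (if w ! k = R then rot_cw q else rot_ccw q)"

definition shift :: "cell \<Rightarrow> patch \<Rightarrow> patch" where
  "shift s M = map (\<lambda>(x, v). (x + s, v)) M"

text \<open>The word is checked, not computed, because it has to appear explicitly in the trace
  later. The result is \<open>None\<close> as soon as the ant stands on a cell outside the patch or
  reads a letter other than the announced one.\<close>

fun follow :: "turn list \<Rightarrow> nat list \<Rightarrow> patch \<times> cell \<times> dir \<Rightarrow> (patch \<times> cell \<times> dir) option" where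
  "follow w [] s = Some s"
| "follow w (k # ts) (M, p, q) =
     (if map_of M p = Some k
      then follow w ts (AList.update p ((k + 1) mod length w) M, p + turned w k q, turned w k q)
      else None)"

text \<open>Two neighbouring patches are run as one, with the ant relative to the origin of
  \<open>A\<close>. Updating existing keys preserves their order, so cutting at
  \<open>length A\<close> separates the patches again.\<close>

definition advance ::
  "turn list \<Rightarrow> nat list \<Rightarrow> patch \<Rightarrow> patch \<Rightarrow> cell \<Rightarrow> dir \<Rightarrow> (patch \<times> patch \<times> cell \<times> dir) option" where
  "advance w ts A B p q =
     (case follow w ts (A @ shift (2, 0) B, p, q) of
        None \<Rightarrow> None
      | Some (M, p', q') \<Rightarrow> Some (take (length A) M, shift (-2, 0) (drop (length A) M), p', q'))"

text \<open>
A strip \<open>(PL, H, U, PR, p, q)\<close> stands, for every \<open>m\<close>, for the row of patches \<open>PL\<close>, \<open>H\<close>, \<open>m\<close> times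
\<open>U\<close>, \<open>PR\<close> whose origins are two columns apart, with the ant at \<open>p\<close> relative to the origin of \<open>PL\<close>.
The ant may enter a unit before it has finished with the previous one. The patch \<open>H\<close> around the ant
therefore travels along during a sweep: a pass replaces \<open>H, U\<close> by \<open>V, H\<close> on the way to the right
and \<open>V, H\<close> by \<open>H, U\<close> on the way to the left.
\<close>

fun lap :: "turn list \<Rightarrow> lap_words \<Rightarrow> strip \<Rightarrow> strip option" where
  "lap w (wL, vR, wR, vL) (PL, H, U, PR, p, q) =
     (case advance w wL PL H p q of None \<Rightarrow> None
      | Some (PL1, H1, p1, q1) \<Rightarrow>
     (case advance w vR H1 U (p1 - (2, 0)) q1 of None \<Rightarrow> None
      | Some (V, H1', p1', q1') \<Rightarrow>
      if (H1', p1', q1') \<noteq> (H1, p1, q1) then None else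
     (case advance w wR H1 PR (p1 - (2, 0)) q1 of None \<Rightarrow> None
      | Some (H2, PR1, p2, q2) \<Rightarrow>
     (case advance w vL V H2 (p2 + (2, 0)) q2 of None \<Rightarrow> None
      | Some (H2', U1, p2', q2') \<Rightarrow>
      if (H2', p2', q2') \<noteq> (H2, p2, q2) then None
      else Some (PL1, H2, U1, PR1, p2 + (2, 0), q2)))))"

fun laps :: "turn list \<Rightarrow> lap_words list \<Rightarrow> nat list \<Rightarrow> strip \<Rightarrow> strip option" where
  "laps w [] wE (PL, H, U, PR, p, q) =
     (case advance w wE PL H p q of None \<Rightarrow> None
      | Some (PL', H', p', q') \<Rightarrow> Some (PL', H', U, PR, p', q'))"
| "laps w (l # ls) wE B = (case lap w l B of None \<Rightarrow> None | Some B' \<Rightarrow> laps w ls wE B')"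

text \<open>After a period, each cell of a new patch is either known from the old patches
  \<open>K\<close> or lies in a region \<open>Z\<close> where 0 is guaranteed; the latter is how the
  front climbs into fresh cells.\<close>

definition covers :: "(cell \<Rightarrow> bool) \<Rightarrow> patch \<Rightarrow> cell \<Rightarrow> patch \<Rightarrow> bool" where
  "covers Z K s N \<longleftrightarrow>
     (\<forall>(x, v) \<in> set N. (x + s, v) \<in> set K \<or> v = 0 \<and> Z (x + s))"

text \<open>
Relative to the origin of \<open>PL\<close>, all cells with ordinate above \<open>h\<close> or abscissa below \<open>l\<close> are \<open>0\<close>.
The laps turn the strip into its translate by \<open>(-2, 2)\<close>, with \<open>\<delta>\<close> more units and with right end
\<open>PR'\<close>. The new first unit comes from the old left end, hence the second copy of \<open>U\<close> in the first
condition.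
\<close>

definition certificate ::
  "turn list \<Rightarrow> int \<Rightarrow> int \<Rightarrow> lap_words list \<Rightarrow> nat list \<Rightarrow>
   patch \<Rightarrow> patch \<Rightarrow> patch \<Rightarrow> patch \<Rightarrow> nat \<Rightarrow> cell \<Rightarrow> dir \<Rightarrow> bool" where
  "certificate w h l ls wE PL U PR PR' \<delta> p q \<longleftrightarrow>
     (case laps w ls wE (PL, U, U, PR, p, q) of None \<Rightarrow> False
      | Some (PL1, H1, U1, PR1, p1, q1) \<Rightarrow>
        p1 = p + (-2, 2) \<and> q1 = q \<and>
        covers (\<lambda>x. snd x > h \<or> fst x < l) (PL1 @ shift (2, 0) H1) (-2, 2)
          (PL @ shift (2, 0) U @ shift (4, 0) U) \<and>
        covers (\<lambda>x. snd x > h) U1 (0, 2) U \<and>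
        covers (\<lambda>x. snd x > h) (PR1 @ shift (-2, 0) U1) (2 * int \<delta> - 2, 2) PR')"

section \<open>Reading words\<close>

text \<open>Besides the word, \<open>S\<close> records where letters are read, which later bounds
  the trajectory. The final position belongs to the next run.\<close>

fun reads :: "turn list \<Rightarrow> cell set \<Rightarrow> ant_conf \<Rightarrow> nat list \<Rightarrow> ant_conf \<Rightarrow> bool" where
  "reads w S C [] C' \<longleftrightarrow> C' = C"
| "reads w S C (k # ts) C' \<longleftrightarrow>
     fst C (fst (snd C)) = k \<and> fst (snd C) \<in> S \<and> reads w S (ant_step w C) ts C'"

lemma ant_step_eq:
  "ant_step w (c, p, q) =
     (c(p := (c p + 1) mod length w), p + turned w (c p) q, turned w (c p) q)"
  by (simp add: ant_step_def turned_def Let_def plus_prod_def)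

lemma reads_append:
  "reads w S C (ts @ us) C'' \<longleftrightarrow> (\<exists>C'. reads w S C ts C' \<and> reads w S C' us C'')"
  by (induction ts arbitrary: C) auto

lemma reads_mono: "reads w S C ts C' \<Longrightarrow> S \<subseteq> T \<Longrightarrow> reads w T C ts C'"
  by (induction ts arbitrary: C) auto

lemma reads_funpow: "reads w S C ts C' \<Longrightarrow> (ant_step w ^^ length ts) C = C'"
  by (induction ts arbitrary: C) (auto simp: funpow_swap1)

lemma ant_trace_0: "ant_trace w C 0 = fst C (fst (snd C))"
  by (simp add: ant_trace_def split: prod.split)

lemma ant_traj_0: "ant_traj w C 0 = fst (snd C)"
  by (simp add: ant_traj_def)

lemma ant_trace_add: "ant_trace w C (m + n) = ant_trace w ((ant_step w ^^ m) C) n"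
  by (simp add: ant_trace_def add.commute[of m] funpow_add)

lemma ant_traj_add: "ant_traj w C (m + n) = ant_traj w ((ant_step w ^^ m) C) n"
  by (simp add: ant_traj_def add.commute[of m] funpow_add)

lemma ant_trace_Suc: "ant_trace w C (Suc n) = ant_trace w (ant_step w C) n"
  using ant_trace_add[of w C 1 n] by simp

lemma ant_traj_Suc: "ant_traj w C (Suc n) = ant_traj w (ant_step w C) n"
  using ant_traj_add[of w C 1 n] by simp

lemma reads_trace_traj:
  "reads w S C ts C' \<Longrightarrow> i < length ts \<Longrightarrow> ant_trace w C i = ts ! i \<and> ant_traj w C i \<in> S"
proof (induction ts arbitrary: C i)
  case (Cons k ts)
  then show ?case
    by (cases i) (auto simp: ant_trace_0 ant_traj_0 ant_trace_Suc ant_traj_Suc)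
qed simp

section \<open>Patches\<close>

definition holds :: "(cell \<Rightarrow> nat) \<Rightarrow> cell \<Rightarrow> patch \<Rightarrow> bool" where
  "holds c d M \<longleftrightarrow> (\<forall>(x, v) \<in> set M. c (x + d) = v)"

definition cells :: "cell \<Rightarrow> patch \<Rightarrow> cell set" where
  "cells d M = (\<lambda>x. x + d) ` fst ` set M"

lemma holds_append [simp]: "holds c d (A @ B) \<longleftrightarrow> holds c d A \<and> holds c d B"
  by (simp add: holds_def ball_Un)

lemma cells_append [simp]: "cells d (A @ B) = cells d A \<union> cells d B"
  by (simp add: cells_def image_Un)

lemma holds_shift [simp]: "holds c d (shift s M) \<longleftrightarrow> holds c (s + d) M"
  by (simp add: holds_def shift_def case_prod_unfold add.assoc)

lemma cells_shift [simp]: "cells d (shift s M) = cells (s + d) M"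
  by (simp add: cells_def shift_def case_prod_unfold image_image add.assoc)

lemma keys_shift: "map fst (shift s M) = map (\<lambda>x. x + s) (map fst M)"
  by (simp add: shift_def case_prod_unfold)

lemma shift_shift: "shift s (shift t M) = shift (t + s) M"
  by (simp add: shift_def case_prod_unfold add.assoc)

lemma shift_0: "shift 0 M = M"
  by (simp add: shift_def)

lemma cells_cong: "map fst M = map fst N \<Longrightarrow> cells d M = cells d N"
  unfolding cells_def by (metis list.set_map)

lemma holds_frame:
  assumes "holds c d M" "\<And>x. x \<in> cells d M \<Longrightarrow> c' x = c x"
  shows "holds c' d M"
  unfolding holds_def
proof
  fix z assume z: "z \<in> set M"
  then have "c (fst z + d) = snd z"
    using assms(1) by (auto simp: holds_def)
  then show "case z of (x, v) \<Rightarrow> c' (x + d) = v"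
    using assms(2)[of "fst z + d"] z by (simp add: cells_def case_prod_unfold)
qed

lemma holds_update:
  assumes "distinct (map fst M)" "holds c d M"
  shows "holds (c(p + d := v)) d (AList.update p v M)"
proof -
  have "c' (x + d) = u" if "(x, u) \<in> set (AList.update p v M)" "c' = c(p + d := v)" for x u c'
  proof -
    have "distinct (map fst (AList.update p v M))"
      using assms(1) by (rule distinct_update)
    then have "map_of (AList.update p v M) x = Some u"
      using that(1) by simp
    then have "((map_of M)(p \<mapsto> v)) x = Some u"
      by (simp add: update_conv')
    then show ?thesis
      using assms that(2) by (auto simp: holds_def split: if_splits dest!: map_of_SomeD)
  qed
  then show ?thesis
    by (auto simp: holds_def)
qed

lemma follow_keys:
  "follow w ts (M, p, q) = Some (M', p', q') \<Longrightarrow> map fst M' = map fst M"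
proof (induction ts arbitrary: M p q)
  case (Cons k ts)
  have "p \<in> set (map fst M)"
    using Cons.prems by (auto split: if_splits dest!: map_of_SomeD intro: image_eqI[rotated])
  then show ?case
    using Cons by (auto simp: update_keys split: if_splits)
qed simp

text \<open>A step depends on and changes only the cell under the ant, and \<open>follow\<close>
  succeeds only while this cell is in the patch. So the run is the same at every translate
  \<open>d\<close>, whatever the other cells contain.\<close>

lemma follow_sound:
  assumes "follow w ts (M, p, q) = Some (M', p', q')" "distinct (map fst M)" "holds c d M"
  shows "\<exists>c'. reads w (cells d M) (c, p + d, q) ts (c', p' + d, q') \<and> holds c' d M' \<and>
          (\<forall>x. x \<notin> cells d M \<longrightarrow> c' x = c x)"
  using assms
proof (induction ts arbitrary: M p q c)
  case Nil
  then show ?case by auto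
next
  case (Cons k ts)
  let ?v = "(k + 1) mod length w" and ?q = "turned w k q"
  let ?M = "AList.update p ?v M"
  from Cons.prems have k: "map_of M p = Some k"
    and run: "follow w ts (?M, p + ?q, ?q) = Some (M', p', q')"
    by (simp_all split: if_splits)
  have p: "(p, k) \<in> set M"
    using k by (rule map_of_SomeD)
  then have ck: "c (p + d) = k" and pd: "p + d \<in> cells d M"
    using Cons.prems(3) by (force simp: holds_def cells_def)+
  have keys: "map fst ?M = map fst M"
    using p by (force simp: update_keys)
  have dist: "distinct (map fst ?M)"
    using keys Cons.prems(2) by simp
  obtain c' where c':
      "reads w (cells d ?M) (c(p + d := ?v), (p + ?q) + d, ?q) ts (c', p' + d, q')"
      "holds c' d M'" "\<forall>x. x \<notin> cells d ?M \<longrightarrow> c' x = (c(p + d := ?v)) x"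
    using Cons.IH[OF run dist holds_update[OF Cons.prems(2,3)]] by blast
  have "ant_step w (c, p + d, q) = (c(p + d := ?v), (p + ?q) + d, ?q)"
    unfolding ant_step_eq ck by (simp add: ac_simps)
  then have "reads w (cells d M) (c, p + d, q) (k # ts) (c', p' + d, q')"
    using c'(1) pd ck unfolding cells_cong[OF keys] by simp
  moreover have "c' x = c x" if "x \<notin> cells d M" for x
    using c'(3) that pd unfolding cells_cong[OF keys] by (metis fun_upd_other)
  ultimately show ?case
    using c'(2) by blast
qed

lemma advance_follow:
  assumes "advance w ts A B p q = Some (A', B', p', q')"
  shows "follow w ts (A @ shift (2, 0) B, p, q) = Some (A' @ shift (2, 0) B', p', q')"
    and "map fst A' = map fst A" and "map fst B' = map fst B"
proof -
  obtain M where M: "follow w ts (A @ shift (2, 0) B, p, q) = Some (M, p', q')"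
    and A': "A' = take (length A) M" and B': "B' = shift (-2, 0) (drop (length A) M)"
    using assms by (auto simp: advance_def split: option.splits)
  have "(-2, 0) + (2, 0) = (0 :: cell)"
    by (simp add: zero_prod_def)
  then have split: "M = A' @ shift (2, 0) B'"
    by (simp only: A' B' shift_shift shift_0 append_take_drop_id)
  then show "follow w ts (A @ shift (2, 0) B, p, q) = Some (A' @ shift (2, 0) B', p', q')"
    using M by simp
  have keys: "map fst M = map fst (A @ shift (2, 0) B)"
    using M by (rule follow_keys)
  have len: "length A' = length A"
    using arg_cong[OF keys, of length] by (simp add: A')
  show "map fst A' = map fst A"
    using keys len by (simp add: split append_eq_append_conv)
  have "map fst (shift (2, 0) B') = map fst (shift (2, 0) B)"
    using keys len by (simp add: split append_eq_append_conv)
  then show "map fst B' = map fst B"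
    unfolding keys_shift by (simp add: inj_map_eq_map[OF injI] del: map_map)
qed

section \<open>Rows of patches\<close>

definition slot :: "nat \<Rightarrow> cell" where
  "slot k = (2 * int k, 0)"

definition band :: "(cell \<Rightarrow> nat) \<Rightarrow> cell \<Rightarrow> patch list \<Rightarrow> bool" where
  "band c d As \<longleftrightarrow> (\<forall>k < length As. holds c (slot k + d) (As ! k))"

definition band_cells :: "cell \<Rightarrow> patch list \<Rightarrow> cell set" where
  "band_cells d As = (\<Union>k < length As. cells (slot k + d) (As ! k))"

text \<open>The first patch may extend to the left and the last one to the right; those in between
  stay in their columns 0 and 1.\<close>

definition separated :: "cell list list \<Rightarrow> bool" where
  "separated Ks \<longleftrightarrow>
     (\<forall>k < length Ks. distinct (Ks ! k) \<and>
        (Suc k < length Ks \<longrightarrow> (\<forall>x \<in> set (Ks ! k). fst x < 2)) \<and>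
        (0 < k \<longrightarrow> (\<forall>x \<in> set (Ks ! k). 0 \<le> fst x)))"

abbreviation keys :: "patch list \<Rightarrow> cell list list" where
  "keys \<equiv> map (map fst)"

lemma keys_nth: "keys As = keys Bs \<Longrightarrow> k < length As \<Longrightarrow> map fst (As ! k) = map fst (Bs ! k)"
  by (metis length_map nth_map)

lemma keys_length: "keys As = keys Bs \<Longrightarrow> length As = length Bs"
  by (metis length_map)

lemma separatedD:
  assumes "separated (keys As)" "k < length As"
  shows "distinct (map fst (As ! k))"
    and "Suc k < length As \<Longrightarrow> x \<in> set (map fst (As ! k)) \<Longrightarrow> fst x < 2"
    and "0 < k \<Longrightarrow> x \<in> set (map fst (As ! k)) \<Longrightarrow> 0 \<le> fst x"
  using assms unfolding separated_def by (metis length_map nth_map)+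

lemma band_cells_cong: "keys As = keys Bs \<Longrightarrow> band_cells d As = band_cells d Bs"
  unfolding band_cells_def by (metis (no_types, lifting) cells_cong keys_nth keys_length lessThan_iff SUP_cong)

text \<open>For \<open>i < j\<close>, patch \<open>i\<close> ends before column
  \<open>2 * i + 2\<close> and patch \<open>j\<close> begins at column \<open>2 * j\<close> or
  later, relative to \<open>d\<close>.\<close>

lemma separated_disjoint:
  assumes "separated (keys As)" "i < length As" "j < length As" "i \<noteq> j"
  shows "cells (slot i + d) (As ! i) \<inter> cells (slot j + d) (As ! j) = {}"
proof -
  have "cells (slot i + d) (As ! i) \<inter> cells (slot j + d) (As ! j) = {}"
    if "i < j" "i < length As" "j < length As" for i j
  proof -
    have "fst x < 2 * int i + 2 + fst d" if "x \<in> cells (slot i + d) (As ! i)" for x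
    proof -
      obtain x' where "x' \<in> fst ` set (As ! i)" "x = x' + (slot i + d)"
        using \<open>x \<in> _\<close> unfolding cells_def by blast
      then show ?thesis
        using separatedD(2)[OF assms(1), of i x'] \<open>i < j\<close> \<open>j < length As\<close>
        by (simp add: slot_def)
    qed
    moreover have "2 * int j + fst d \<le> fst x" if "x \<in> cells (slot j + d) (As ! j)" for x
    proof -
      obtain x' where "x' \<in> fst ` set (As ! j)" "x = x' + (slot j + d)"
        using \<open>x \<in> _\<close> unfolding cells_def by blast
      then show ?thesis
        using separatedD(3)[OF assms(1), of j x'] \<open>i < j\<close> \<open>j < length As\<close>
        by (simp add: slot_def)
    qed
    moreover have "2 * int i + 2 \<le> 2 * int j"
      using \<open>i < j\<close> by simp
    ultimately show ?thesis
      by force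
  qed
  then show ?thesis
    using assms(2-4) by (metis inf_commute linorder_neqE_nat)
qed

text \<open>Quantifying over \<open>c\<close> and \<open>d\<close> makes this a statement about
  local patterns. The keys are preserved so that the occupied region and \<open>separated\<close>
  carry over and moves compose.\<close>

definition moves ::
  "turn list \<Rightarrow> patch list \<times> cell \<times> dir \<Rightarrow> nat list \<Rightarrow> patch list \<times> cell \<times> dir \<Rightarrow> bool" where
  "moves w s ts s' \<longleftrightarrow> (case s of (As, p, q) \<Rightarrow> case s' of (Bs, p', q') \<Rightarrow>
     keys Bs = keys As \<and>
     (\<forall>c d. band c d As \<longrightarrow>
       (\<exists>c'. reads w (band_cells d As) (c, p + d, q) ts (c', p' + d, q') \<and> band c' d Bs \<and>
             (\<forall>x. x \<notin> band_cells d As \<longrightarrow> c' x = c x))))"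

lemma movesD:
  assumes "moves w (As, p, q) ts (Bs, p', q')"
  shows "keys Bs = keys As"
    and "band c d As \<Longrightarrow> \<exists>c'. reads w (band_cells d As) (c, p + d, q) ts (c', p' + d, q') \<and>
      band c' d Bs \<and> (\<forall>x. x \<notin> band_cells d As \<longrightarrow> c' x = c x)"
  using assms unfolding moves_def prod.case by blast+

lemma moves_refl: "moves w s [] s"
  by (cases s) (auto simp: moves_def)

lemma moves_trans:
  assumes "moves w s ts s'" "moves w s' us s''"
  shows "moves w s (ts @ us) s''"
proof -
  obtain As p q Bs p' q' Cs p'' q'' where
    s: "s = (As, p, q)" "s' = (Bs, p', q')" "s'' = (Cs, p'', q'')"
    by (metis prod_cases3)
  note keys = movesD(1)[OF assms(1)[unfolded s]] movesD(1)[OF assms(2)[unfolded s]]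
  have "\<exists>c''. reads w (band_cells d As) (c, p + d, q) (ts @ us) (c'', p'' + d, q'') \<and>
      band c'' d Cs \<and> (\<forall>x. x \<notin> band_cells d As \<longrightarrow> c'' x = c x)" if c: "band c d As" for c d
  proof -
    obtain c' where c': "reads w (band_cells d As) (c, p + d, q) ts (c', p' + d, q')"
        "band c' d Bs" "\<forall>x. x \<notin> band_cells d As \<longrightarrow> c' x = c x"
      using movesD(2)[OF assms(1)[unfolded s] c] by blast
    then obtain c'' where "reads w (band_cells d Bs) (c', p' + d, q') us (c'', p'' + d, q'')"
        "band c'' d Cs" "\<forall>x. x \<notin> band_cells d Bs \<longrightarrow> c'' x = c' x"
      using movesD(2)[OF assms(2)[unfolded s]] by blast
    with c' show ?thesis
      unfolding reads_append band_cells_cong[OF keys(1)] by metis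
  qed
  then show ?thesis
    using keys unfolding moves_def s prod.case by metis
qed

lemma slot_Suc: "slot (Suc k) = (2, 0) + slot k"
  by (simp add: slot_def)

text \<open>The two active patches are disjoint from all others in the row, so a run confined to
  them leaves the rest of the row intact.\<close>

lemma moves_local:
  assumes sep: "separated (keys (Xs @ A # B # Ys))" (is "separated (keys ?As)")
    and adv: "advance w ts A B p q = Some (A', B', p', q')"
  shows "moves w (Xs @ A # B # Ys, p + slot (length Xs), q) ts
                 (Xs @ A' # B' # Ys, p' + slot (length Xs), q')" (is "moves w _ _ (?Bs, _)")
proof -
  let ?n = "length Xs"
  note adv' = advance_follow[OF adv]
  have nth: "?As ! ?n = A" "?As ! Suc ?n = B" "?Bs ! ?n = A'" "?Bs ! Suc ?n = B'"
    by (simp_all add: nth_append)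
  have nth': "?Bs ! k = ?As ! k" if "k \<noteq> ?n" "k \<noteq> Suc ?n" for k
    using that by (auto simp: nth_append nth_Cons')
  have n: "?n < length ?As" "Suc ?n < length ?As"
    by auto
  have "distinct (map fst A)" "distinct (map fst B)"
    using separatedD(1)[OF sep n(1)] separatedD(1)[OF sep n(2)] by (simp_all only: nth)
  moreover have "cells (slot ?n + 0) A \<inter> cells (slot (Suc ?n) + 0) B = {}"
    using separated_disjoint[OF sep n, of 0] by (simp only: nth n_not_Suc_n) simp
  then have "set (map fst A) \<inter> set (map fst (shift (2, 0) B)) = {}"
    by (force simp: cells_def slot_Suc keys_shift ac_simps simp del: map_map)
  moreover have "inj_on (\<lambda>x. x + (2, 0)) (set (map fst B))"
    by (auto intro: inj_onI)
  ultimately have dist: "distinct (map fst (A @ shift (2, 0) B))"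
    unfolding map_append distinct_append keys_shift distinct_map[of "\<lambda>x. x + (2, 0)"] by blast
  have "\<exists>c'. reads w (band_cells d ?As) (c, p + slot ?n + d, q) ts (c', p' + slot ?n + d, q') \<and>
      band c' d ?Bs \<and> (\<forall>x. x \<notin> band_cells d ?As \<longrightarrow> c' x = c x)" if c: "band c d ?As" for c d
  proof -
    let ?S = "cells (slot ?n + d) A \<union> cells (slot (Suc ?n) + d) B"
    have "holds c (slot ?n + d) A" "holds c (slot (Suc ?n) + d) B"
      using c n unfolding band_def by (metis nth)+
    then have "holds c (slot ?n + d) (A @ shift (2, 0) B)"
      by (simp add: slot_Suc add.assoc)
    from follow_sound[OF adv'(1) dist this]
    obtain c' where c': "reads w ?S (c, p + slot ?n + d, q) ts (c', p' + slot ?n + d, q')"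
        "holds c' (slot ?n + d) A'" "holds c' (slot (Suc ?n) + d) B'"
        "\<forall>x. x \<notin> ?S \<longrightarrow> c' x = c x"
      by (auto simp: slot_Suc add.assoc)
    have S: "?S \<subseteq> band_cells d ?As"
      unfolding band_cells_def using n nth by fastforce
    have "holds c' (slot k + d) (?Bs ! k)" if "k < length ?Bs" for k
    proof (cases "k = ?n \<or> k = Suc ?n")
      case True
      then show ?thesis
        using c'(2,3) nth by metis
    next
      case False
      have k: "k < length ?As"
        using that by simp
      have "?S \<inter> cells (slot k + d) (?As ! k) = {}"
        using separated_disjoint[OF sep n(1) k, of d] separated_disjoint[OF sep n(2) k, of d] False
        unfolding nth by blast
      then have "c' x = c x" if "x \<in> cells (slot k + d) (?As ! k)" for x
        using c'(4) that by blast
      moreover have "holds c (slot k + d) (?As ! k)"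
        using c k unfolding band_def by blast
      ultimately have "holds c' (slot k + d) (?As ! k)"
        by (rule holds_frame[rotated])
      then show ?thesis
        using False nth'[of k] by simp
    qed
    then have "band c' d ?Bs"
      unfolding band_def by blast
    moreover have "reads w (band_cells d ?As) (c, p + slot ?n + d, q) ts (c', p' + slot ?n + d, q')"
      using c'(1) S by (rule reads_mono)
    ultimately show ?thesis
      using c'(4) S by blast
  qed
  moreover have "keys ?Bs = keys ?As"
    using adv'(2,3) by simp
  ultimately show ?thesis
    unfolding moves_def prod.case by blast
qed

lemma slot_0 [simp]: "slot 0 = 0"
  by (simp add: slot_def zero_prod_def)

text \<open>The assumption says that one pass reproduces \<open>H\<close> and the direction, with
  the ant two columns further. Induction then moves finished copies of \<open>V\<close> into
  \<open>Xs\<close>.\<close>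

lemma sweep_right:
  assumes adv: "advance w v H U p q = Some (V, H, p + (2, 0), q)"
  shows "separated (keys (Xs @ H # replicate m U @ Ys)) \<Longrightarrow>
    moves w (Xs @ H # replicate m U @ Ys, p + slot (length Xs), q) (concat (replicate m v))
            (Xs @ replicate m V @ H # Ys, p + slot (length Xs + m), q)"
proof (induction m arbitrary: Xs)
  case 0
  then show ?case by (simp add: moves_refl)
next
  case (Suc m)
  have step: "moves w (Xs @ H # U # replicate m U @ Ys, p + slot (length Xs), q) v
     (Xs @ V # H # replicate m U @ Ys, p + (2, 0) + slot (length Xs), q)"
    using moves_local[OF _ adv] Suc.prems by simp
  have eq: "p + (2, 0) + slot (length Xs) = p + slot (length (Xs @ [V]))"
    by (simp add: slot_Suc add.assoc)
  have "separated (keys (Xs @ V # H # replicate m U @ Ys))"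
    using Suc.prems by (simp only: movesD(1)[OF step] replicate_Suc append_Cons)
  then have "moves w (Xs @ V # H # replicate m U @ Ys, p + (2, 0) + slot (length Xs), q)
     (concat (replicate m v)) (Xs @ V # replicate m V @ H # Ys, p + slot (length Xs + Suc m), q)"
    using Suc.IH[of "Xs @ [V]"] by (simp add: eq)
  from moves_trans[OF step this] show ?case by simp
qed

text \<open>Mirror image of the sweep to the right: the last \<open>V\<close> is converted first,
  and finished units accumulate in \<open>Ys\<close>. The pass starts at \<open>p + (2, 0)\<close>
  because positions are relative to \<open>V\<close>, while the ant is near
  \<open>H\<close>.\<close>

lemma sweep_left:
  assumes adv: "advance w v V H (p + (2, 0)) q = Some (H, U, p, q)"
  shows "separated (keys (Xs @ replicate m V @ H # Ys)) \<Longrightarrow>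
    moves w (Xs @ replicate m V @ H # Ys, p + slot (length Xs + m), q) (concat (replicate m v))
            (Xs @ H # replicate m U @ Ys, p + slot (length Xs), q)"
proof (induction m arbitrary: Ys)
  case 0
  then show ?case by (simp add: moves_refl)
next
  case (Suc m)
  have list: "Xs @ replicate (Suc m) V @ H # Ys = (Xs @ replicate m V) @ V # H # Ys"
    by (simp add: replicate_app_Cons_same)
  have eq: "p + slot (length Xs + Suc m) = p + (2, 0) + slot (length (Xs @ replicate m V))"
    by (simp add: slot_Suc add.assoc)
  have step: "moves w (Xs @ replicate (Suc m) V @ H # Ys, p + slot (length Xs + Suc m), q) v
     ((Xs @ replicate m V) @ H # U # Ys, p + slot (length (Xs @ replicate m V)), q)"
    unfolding list eq by (rule moves_local[OF _ adv]) (use Suc.prems in \<open>simp only: list\<close>)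
  have sep: "separated (keys (Xs @ replicate m V @ H # U # Ys))"
    using Suc.prems movesD(1)[OF step] by (simp only: append_assoc)
  have "moves w (Xs @ replicate (Suc m) V @ H # Ys, p + slot (length Xs + Suc m), q)
     (v @ concat (replicate m v)) (Xs @ H # replicate m U @ U # Ys, p + slot (length Xs), q)"
    using moves_trans[OF step] Suc.IH[OF sep] by simp
  then show ?case
    by (simp add: replicate_app_Cons_same)
qed

section \<open>Laps and the interleaved words read during them\<close>

definition interleave :: "('a list \<times> 'a list) list \<Rightarrow> nat \<Rightarrow> 'a list" where
  "interleave ps n = concat (map (\<lambda>(u, v). u @ concat (replicate n v)) ps)"

text \<open>Any failing \<open>advance\<close> or comparison makes the whole lap
  \<open>None\<close>, so success yields four advances in which both passes restore the travelling
  patch.\<close>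

lemma lapE:
  assumes lap: "lap w (wL, vR, wR, vL) (PL, H, U, PR, p, q) = Some (PL', H', U', PR', p', q')"
  obtains H1 p1 q1 V p2 where
    "advance w wL PL H p q = Some (PL', H1, p1, q1)"
    "advance w vR H1 U (p1 - (2, 0)) q1 = Some (V, H1, p1, q1)"
    "advance w wR H1 PR (p1 - (2, 0)) q1 = Some (H', PR', p2, q')"
    "advance w vL V H' (p2 + (2, 0)) q' = Some (H', U', p2, q')"
    "p' = p2 + (2, 0)"
proof -
  have some: "\<exists>A B x y. r = Some (A, B, x, y)" if "r \<noteq> None"
    for r :: "(patch \<times> patch \<times> cell \<times> dir) option"
    using that by (metis option.exhaust prod_cases4)
  have "advance w wL PL H p q \<noteq> None"
    using lap by (rule contrapos_pn) simp
  then obtain PL1 H1 p1 q1 where left: "advance w wL PL H p q = Some (PL1, H1, p1, q1)"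
    using some by blast
  note lap = lap[unfolded lap.simps left option.case prod.case]
  have "advance w vR H1 U (p1 - (2, 0)) q1 \<noteq> None"
    using lap by (rule contrapos_pn) simp
  then obtain V H1' p1' q1' where
    right: "advance w vR H1 U (p1 - (2, 0)) q1 = Some (V, H1', p1', q1')"
    using some by blast
  note lap = lap[unfolded right option.case prod.case]
  have eq1: "H1' = H1" "p1' = p1" "q1' = q1"
    using lap by (metis option.distinct(1) prod.inject)+
  note lap = lap[unfolded eq1 simp_thms if_False]
  have "advance w wR H1 PR (p1 - (2, 0)) q1 \<noteq> None"
    using lap by (rule contrapos_pn) simp
  then obtain H2 PR1 p2 q2 where
    turn: "advance w wR H1 PR (p1 - (2, 0)) q1 = Some (H2, PR1, p2, q2)"
    using some by blast
  note lap = lap[unfolded turn option.case prod.case]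
  have "advance w vL V H2 (p2 + (2, 0)) q2 \<noteq> None"
    using lap by (rule contrapos_pn) simp
  then obtain H2' U1 p2' q2' where
    home: "advance w vL V H2 (p2 + (2, 0)) q2 = Some (H2', U1, p2', q2')"
    using some by blast
  note lap = lap[unfolded home option.case prod.case]
  have eq2: "H2' = H2" "p2' = p2" "q2' = q2"
    using lap by (metis option.distinct(1) prod.inject)+
  have fin: "PL1 = PL'" "H2 = H'" "U1 = U'" "PR1 = PR'" "q2 = q'" and p': "p' = p2 + (2, 0)"
    using lap unfolding eq2 by (simp_all only: simp_thms if_False option.inject prod.inject)
  show ?thesis
    using that[OF left[unfolded fin] right[unfolded eq1] turn[unfolded fin]
        home[unfolded eq2 fin] p'] .
qed

text \<open>Four moves are chained: the left end, \<open>m\<close> passes to the right, the turn at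
  the right end, \<open>m\<close> passes to the left. The intermediate units \<open>V\<close> exist
  only between the two sweeps.\<close>

lemma lap_sound:
  assumes lap: "lap w (wL, vR, wR, vL) (PL, H, U, PR, p, q) = Some (PL', H', U', PR', p', q')"
    and sep: "separated (keys (PL # H # replicate m U @ [PR]))"
  shows "moves w (PL # H # replicate m U @ [PR], p, q) (interleave [(wL, vR), (wR, vL)] m)
                 (PL' # H' # replicate m U' @ [PR'], p', q')"
proof -
  obtain H1 p1 q1 V p2 where
    left: "advance w wL PL H p q = Some (PL', H1, p1, q1)" and
    right: "advance w vR H1 U (p1 - (2, 0)) q1 = Some (V, H1, p1, q1)" and
    turn: "advance w wR H1 PR (p1 - (2, 0)) q1 = Some (H', PR', p2, q')" and
    home: "advance w vL V H' (p2 + (2, 0)) q' = Some (H', U', p2, q')" and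
    p': "p' = p2 + (2, 0)"
    using lap by (rule lapE)
  have p1: "p1 - (2, 0) + (2, 0) = p1"
    by simp
  have m1: "moves w (PL # H # replicate m U @ [PR], p, q) wL
      ([PL'] @ H1 # replicate m U @ [PR], p1 - (2, 0) + slot (length [PL']), q1)"
    using moves_local[OF _ left, of "[]"] sep by (simp add: slot_Suc p1)
  have m2: "moves w ([PL'] @ H1 # replicate m U @ [PR], p1 - (2, 0) + slot (length [PL']), q1)
      (concat (replicate m vR))
      ([PL'] @ replicate m V @ [H1, PR], p1 - (2, 0) + slot (length [PL'] + m), q1)"
    using sweep_right[of w vR H1 U "p1 - (2, 0)" q1 V "[PL']" m "[PR]"] right
      sep[folded movesD(1)[OF m1]]
    by (simp add: p1)
  note m12 = moves_trans[OF m1 m2]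
  have m3: "moves w ([PL'] @ replicate m V @ [H1, PR], p1 - (2, 0) + slot (length [PL'] + m), q1) wR
      ([PL'] @ replicate m V @ [H', PR'], p2 + slot (length [PL'] + m), q')"
    using moves_local[OF _ turn, of "[PL'] @ replicate m V" "[]"]
      sep[folded movesD(1)[OF m12]]
    by simp
  note m13 = moves_trans[OF m12 m3]
  have m4: "moves w ([PL'] @ replicate m V @ [H', PR'], p2 + slot (length [PL'] + m), q')
      (concat (replicate m vL))
      ([PL'] @ H' # replicate m U' @ [PR'], p2 + slot (length [PL']), q')"
    using sweep_left[OF home, of "[PL']" m "[PR']"] sep[folded movesD(1)[OF m13]] by simp
  show ?thesis
    using moves_trans[OF m13 m4] by (simp add: interleave_def slot_Suc p')
qed

fun lap_pairs :: "lap_words \<Rightarrow> (nat list \<times> nat list) list" where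
  "lap_pairs (wL, vR, wR, vL) = [(wL, vR), (wR, vL)]"

text \<open>The closing word \<open>wE\<close> is read at the left end only, hence its empty
  repeated word.\<close>

definition laps_pairs :: "lap_words list \<Rightarrow> nat list \<Rightarrow> (nat list \<times> nat list) list" where
  "laps_pairs ls wE = concat (map lap_pairs ls) @ [(wE, [])]"

lemma laps_sound:
  assumes "laps w ls wE (PL, H, U, PR, p, q) = Some (PL', H', U', PR', p', q')"
    and "separated (keys (PL # H # replicate m U @ [PR]))"
  shows "moves w (PL # H # replicate m U @ [PR], p, q) (interleave (laps_pairs ls wE) m)
                 (PL' # H' # replicate m U' @ [PR'], p', q')"
  using assms
proof (induction ls arbitrary: PL H U PR p q)
  case Nil
  then have adv: "advance w wE PL H p q = Some (PL', H', p', q')" and "U' = U" "PR' = PR"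
    by (auto split: option.splits)
  then show ?case
    using moves_local[OF _ adv, of "[]"] Nil.prems(2)
    by (simp add: interleave_def laps_pairs_def)
next
  case (Cons l ls)
  obtain wL vR wR vL where l: "l = (wL, vR, wR, vL)"
    by (metis prod_cases4)
  obtain PL1 H1 U1 PR1 p1 q1 where
    lap: "lap w (wL, vR, wR, vL) (PL, H, U, PR, p, q) = Some (PL1, H1, U1, PR1, p1, q1)" and
    rest: "laps w ls wE (PL1, H1, U1, PR1, p1, q1) = Some (PL', H', U', PR', p', q')"
    using Cons.prems(1) by (auto simp: l simp del: lap.simps split: option.splits)
  note m1 = lap_sound[OF lap Cons.prems(2)]
  have "separated (keys (PL1 # H1 # replicate m U1 @ [PR1]))"
    using Cons.prems(2) by (simp only: movesD(1)[OF m1])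
  from moves_trans[OF m1 Cons.IH[OF rest this]] show ?case
    by (simp add: interleave_def laps_pairs_def l)
qed

text \<open>The first sweep is stopped after \<open>j\<close> passes by counting the remaining units
  to the right part \<open>Ys\<close>. These positions later show that the whole front is
  visited.\<close>

lemma sweep_position:
  assumes left: "advance w wL PL U p q = Some (PL', H, p', q')"
    and right: "advance w vR H U (p' - (2, 0)) q' = Some (V, H, p', q')"
    and sep: "separated (keys (PL # U # replicate m U @ [PR]))"
    and band: "band c d (PL # U # replicate m U @ [PR])" and "j \<le> m"
  shows "ant_traj w (c, p + d, q) (length wL + j * length vR) = p' + slot j + d"
proof -
  have p': "p' - (2, 0) + (2, 0) = p'"
    by simp
  define Ys where "Ys = replicate (m - j) U @ [PR]"
  have rep: "replicate m U @ [PR] = replicate j U @ Ys"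
    using \<open>j \<le> m\<close> by (simp add: Ys_def flip: append_assoc replicate_add)
  have m1: "moves w (PL # U # replicate j U @ Ys, p, q) wL
      ([PL'] @ H # replicate j U @ Ys, p' - (2, 0) + slot (length [PL']), q')"
    using moves_local[OF _ left, of "[]"] sep by (simp add: slot_Suc p' rep)
  have m2: "moves w ([PL'] @ H # replicate j U @ Ys, p' - (2, 0) + slot (length [PL']), q')
      (concat (replicate j vR))
      ([PL'] @ replicate j V @ H # Ys, p' - (2, 0) + slot (length [PL'] + j), q')"
    using sweep_right[of w vR H U "p' - (2, 0)" q' V "[PL']" j Ys] right
      sep[unfolded rep, folded movesD(1)[OF m1]]
    by (simp add: p')
  have "\<exists>S c'. reads w S (c, p + d, q) (wL @ concat (replicate j vR))
      (c', p' - (2, 0) + slot (length [PL'] + j) + d, q')"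
    using movesD(2)[OF moves_trans[OF m1 m2]] band[unfolded rep] by blast
  then show ?thesis
    by (auto dest!: reads_funpow simp: ant_traj_def slot_Suc p' length_concat sum_list_replicate)
qed

section \<open>Certified periods\<close>

definition settled :: "int \<Rightarrow> int \<Rightarrow> (cell \<Rightarrow> nat) \<Rightarrow> cell \<Rightarrow> patch list \<Rightarrow> bool" where
  "settled h l c d As \<longleftrightarrow> band c d As \<and> (\<forall>x. snd x > h \<or> fst x < l \<longrightarrow> c (x + d) = 0)"

definition framed :: "patch \<Rightarrow> patch \<Rightarrow> nat \<Rightarrow> patch \<Rightarrow> patch list" where
  "framed PL U n PR = PL # replicate n U @ [PR]"

text \<open>The bounds \<open>h\<close> and \<open>l\<close> keep the row out of the region assumed
  to be 0, \<open>b\<close> will bound the trajectory, and \<open>n\<close> is the number of cell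
  states.\<close>

definition fits :: "nat \<Rightarrow> int \<Rightarrow> int \<Rightarrow> int \<Rightarrow> patch \<Rightarrow> patch \<Rightarrow> patch \<Rightarrow> bool" where
  "fits n b h l PL U PR \<longleftrightarrow> l \<le> 0 \<and>
     distinct (map fst PL) \<and> distinct (map fst U) \<and> distinct (map fst PR) \<and>
     (\<forall>x \<in> set (map fst PL). l \<le> fst x \<and> fst x < 2) \<and>
     (\<forall>x \<in> set (map fst U). 0 \<le> fst x \<and> fst x < 2) \<and>
     (\<forall>x \<in> set (map fst PR). 0 \<le> fst x) \<and>
     (\<forall>x \<in> set (map fst (PL @ U @ PR)). \<bar>fst x\<bar> \<le> b \<and> \<bar>snd x\<bar> \<le> b \<and> snd x \<le> h) \<and>
     (\<forall>v \<in> set (map snd (PL @ U @ PR)). v < n)"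

lemma length_framed [simp]: "length (framed PL U n PR) = n + 2"
  by (simp add: framed_def)

lemma framed_nth:
  "framed PL U n PR ! 0 = PL"
  "0 < k \<Longrightarrow> k \<le> n \<Longrightarrow> framed PL U n PR ! k = U"
  "framed PL U n PR ! Suc n = PR"
  by (auto simp: framed_def nth_Cons' nth_append)

lemma framed_cases:
  assumes "k < n + 2"
  obtains "k = 0" | "0 < k" "k \<le> n" | "k = Suc n"
  using assms by linarith

lemma fits_separated: "fits v b h l PL U PR \<Longrightarrow> separated (keys (framed PL U n PR))"
  unfolding separated_def length_map length_framed
proof (intro allI impI)
  fix k assume fits: "fits v b h l PL U PR" and k: "k < n + 2"
  from k show "distinct (keys (framed PL U n PR) ! k) \<and>
     (Suc k < n + 2 \<longrightarrow> (\<forall>x\<in>set (keys (framed PL U n PR) ! k). fst x < 2)) \<and>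
     (0 < k \<longrightarrow> (\<forall>x\<in>set (keys (framed PL U n PR) ! k). 0 \<le> fst x))"
    by (cases rule: framed_cases) (use fits in \<open>auto simp: fits_def framed_nth\<close>)
qed

lemma band_cells_framed:
  assumes fits: "fits v b h l PL U PR" and x: "x + d \<in> band_cells d (framed PL U n PR)"
  shows "snd x \<le> h" "l \<le> fst x" "- b \<le> fst x" "fst x \<le> 2 * int n + 2 + b" "\<bar>snd x\<bar> \<le> b"
proof -
  obtain k where k: "k < n + 2" and "x + d \<in> cells (slot k + d) (framed PL U n PR ! k)"
    using x unfolding band_cells_def length_framed by blast
  then obtain y where y: "y \<in> set (map fst (framed PL U n PR ! k))"
    and "x + d = y + (slot k + d)"
    unfolding cells_def list.set_map by blast
  then have eq: "x = y + slot k"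
    by (metis add.assoc add_right_cancel)
  from k have "(l \<le> fst y \<or> 0 \<le> fst y) \<and> \<bar>fst y\<bar> \<le> b \<and> \<bar>snd y\<bar> \<le> b \<and> snd y \<le> h"
    by (cases rule: framed_cases) (use fits y in \<open>auto simp: fits_def framed_nth\<close>)
  moreover have "l \<le> 0"
    using fits by (simp add: fits_def)
  ultimately show "snd x \<le> h" "l \<le> fst x" "- b \<le> fst x" "fst x \<le> 2 * int n + 2 + b" "\<bar>snd x\<bar> \<le> b"
    using k by (auto simp: eq slot_def)
qed

lemma covers_holds:
  assumes "covers Z K s N" "holds c d K" "\<And>x. Z x \<Longrightarrow> c (x + d) = 0"
  shows "holds c (s + d) N"
  unfolding holds_def
proof
  fix z assume "z \<in> set N"
  then have "(fst z + s, snd z) \<in> set K \<or> snd z = 0 \<and> Z (fst z + s)"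
    using assms(1) by (auto simp: covers_def)
  then have "c (fst z + s + d) = snd z"
    using assms(2) assms(3)[of "fst z + s"] unfolding holds_def by fastforce
  then show "case z of (x, v) \<Rightarrow> c (x + (s + d)) = v"
    by (simp add: case_prod_unfold add.assoc)
qed

lemma bandD: "band c d As \<Longrightarrow> k < length As \<Longrightarrow> holds c (slot k + d) (As ! k)"
  by (simp add: band_def)

text \<open>The laps are run by \<open>laps_sound\<close>, then the three \<open>covers\<close>
  conditions rebuild the row at its new origin. New slot \<open>k\<close> lies two cells above old
  slot \<open>k - 1\<close>.\<close>

lemma certificate_step:
  assumes cert: "certificate w h l ls wE PL U PR PR' \<delta> p q"
    and fits: "fits v b h l PL U PR" and "\<delta> \<le> 1" "1 \<le> m"
    and settled: "settled h l c d (framed PL U (Suc m) PR)"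
  shows "\<exists>c'. reads w (band_cells d (framed PL U (Suc m) PR)) (c, p + d, q)
      (interleave (laps_pairs ls wE) m) (c', p + ((-2, 2) + d), q) \<and>
    settled h l c' ((-2, 2) + d) (framed PL U (Suc (m + \<delta>)) PR')"
proof -
  let ?As = "framed PL U (Suc m) PR" and ?d = "(-2, 2) + d"
  obtain PL1 H1 U1 PR1 where
    laps: "laps w ls wE (PL, U, U, PR, p, q) = Some (PL1, H1, U1, PR1, p + (-2, 2), q)" and
    cov1: "covers (\<lambda>x. snd x > h \<or> fst x < l) (PL1 @ shift (2, 0) H1) (-2, 2)
       (PL @ shift (2, 0) U @ shift (4, 0) U)" and
    cov2: "covers (\<lambda>x. snd x > h) U1 (0, 2) U" and
    cov3: "covers (\<lambda>x. snd x > h) (PR1 @ shift (-2, 0) U1) (2 * int \<delta> - 2, 2) PR'"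
    using cert by (auto simp: certificate_def simp del: laps.simps split: option.splits)
  have As: "?As = PL # U # replicate m U @ [PR]"
    by (simp add: framed_def)
  note run = laps_sound[OF laps fits_separated[OF fits, of "Suc m", unfolded As], folded As]
  obtain c' where c': "reads w (band_cells d ?As) (c, p + d, q)
        (interleave (laps_pairs ls wE) m) (c', p + (-2, 2) + d, q)"
      "band c' d (PL1 # H1 # replicate m U1 @ [PR1])"
      "\<forall>x. x \<notin> band_cells d ?As \<longrightarrow> c' x = c x"
    using movesD(2)[OF run] settled unfolding settled_def by blast
  \<comment> \<open>The run does not change cells outside the row, and the row does not meet this
    region.\<close>
  have zero: "c' (x + d) = 0" if "snd x > h \<or> fst x < l" for x
  proof -
    have "x + d \<notin> band_cells d ?As"
      using band_cells_framed(1,2)[OF fits, of x] that by (meson leD)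
    then show ?thesis
      using c'(3) settled that unfolding settled_def by metis
  qed
  have PL1: "holds c' d PL1" and H1: "holds c' ((2, 0) + d) H1"
    using bandD[OF c'(2), of 0] bandD[OF c'(2), of 1] by (simp_all add: slot_Suc)
  have U1: "holds c' (slot k + d) U1" if "2 \<le> k" "k \<le> Suc m" for k
  proof -
    have "k - Suc (Suc 0) < m" "k - Suc 0 \<noteq> 0" "k \<noteq> 0"
      using that by linarith+
    then show ?thesis
      using bandD[OF c'(2), of k] that by (simp add: nth_Cons' nth_append)
  qed
  have PR1: "holds c' (slot (m + 2) + d) PR1"
    using bandD[OF c'(2), of "m + 2"] by (simp add: nth_append)
  have "holds c' ((-2, 2) + d) (PL @ shift (2, 0) U @ shift (4, 0) U)"
    using PL1 H1 by (intro covers_holds[OF cov1] zero) simp_all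
  then have left: "holds c' ?d PL" "holds c' (slot 1 + ?d) U" "holds c' (slot 2 + ?d) U"
    by (simp_all add: slot_def)
  \<comment> \<open>Slots 1 and 2 come from the old left end and \<open>H1\<close>. Every later slot
    \<open>k\<close> comes from the old unit at \<open>k - 1\<close>, which exists since
    \<open>k - 1 \<le> m + 1\<close> by \<open>\<delta> \<le> 1\<close>.\<close>
  have mid: "holds c' (slot k + ?d) U" if k: "0 < k" "k \<le> Suc (m + \<delta>)" for k
  proof -
    consider "k = 1" | "k = 2" | "3 \<le> k"
      using k by linarith
    then show ?thesis
    proof cases
      case 3
      have "c' (x + (slot (k - 1) + d)) = 0" if "snd x > h" for x
        using zero[of "x + slot (k - 1)"] that by (simp add: slot_def add.assoc)
      then have "holds c' ((0, 2) + (slot (k - 1) + d)) U"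
        using U1[of "k - 1"] 3 k \<open>\<delta> \<le> 1\<close> by (intro covers_holds[OF cov2]) auto
      moreover have "(0, 2) + (slot (k - 1) + d) = slot k + ?d"
        using 3 by (cases d) (simp add: slot_def)
      ultimately show ?thesis
        by (simp only:)
    qed (use left in simp_all)
  qed
  have right: "holds c' (slot (Suc (Suc (m + \<delta>))) + ?d) PR'"
  proof -
    have "c' (x + (slot (m + 2) + d)) = 0" if "snd x > h" for x
      using zero[of "x + slot (m + 2)"] that by (simp add: slot_def add.assoc)
    moreover have "(-2, 0) + (slot (m + 2) + d) = slot (m + 1) + d"
      by (cases d) (simp add: slot_def)
    then have "holds c' (slot (m + 2) + d) (PR1 @ shift (-2, 0) U1)"
      using PR1 U1[of "m + 1"] \<open>1 \<le> m\<close> by (simp only: holds_append holds_shift)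
    ultimately have "holds c' ((2 * int \<delta> - 2, 2) + (slot (m + 2) + d)) PR'"
      by (intro covers_holds[OF cov3])
    moreover have "(2 * int \<delta> - 2, 2) + (slot (m + 2) + d) = slot (Suc (Suc (m + \<delta>))) + ?d"
      by (cases d) (simp add: slot_def)
    ultimately show ?thesis
      by (simp only:)
  qed
  have "holds c' (slot k + ?d) (framed PL U (Suc (m + \<delta>)) PR' ! k)"
    if "k < Suc (m + \<delta>) + 2" for k
    using that by (cases rule: framed_cases) (use left mid right in \<open>simp_all add: framed_nth\<close>)
  then have "band c' ?d (framed PL U (Suc (m + \<delta>)) PR')"
    by (simp add: band_def)
  moreover have "c' (x + ?d) = 0" if "snd x > h \<or> fst x < l" for x
    using zero[of "x + (-2, 2)"] that by (auto simp: add.assoc)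
  ultimately have "settled h l c' ?d (framed PL U (Suc (m + \<delta>)) PR')"
    by (simp add: settled_def)
  then show ?thesis
    using c'(1) by (auto simp: add.assoc)
qed

text \<open>Disjoint patches with distinct keys prescribe at most one value per cell, so the choice
  in \<open>c\<close> is determined on the row and can be completed by 0.\<close>

lemma band_exists:
  assumes sep: "separated (keys As)"
    and small: "\<And>A v. A \<in> set As \<Longrightarrow> v \<in> set (map snd A) \<Longrightarrow> v < n" and "0 < n"
  shows "\<exists>c. band c 0 As \<and> (\<forall>x. x \<notin> band_cells 0 As \<longrightarrow> c x = 0) \<and> (\<forall>x. c x < n)"
proof -
  define val where "val x v \<longleftrightarrow> (\<exists>k < length As. (x - slot k, v) \<in> set (As ! k))" for x v
  define c where "c x = (if x \<in> band_cells 0 As then SOME v. val x v else 0)" for x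
  have cell: "x \<in> cells (slot k + 0) (As ! k)" if "(x - slot k, v) \<in> set (As ! k)" for x k v
    using that unfolding cells_def by force
  have ex: "\<exists>v. val x v" if "x \<in> band_cells 0 As" for x
    using that unfolding band_cells_def cells_def val_def by force
  have uniq: "v = v'" if vals: "val x v" "val x v'" for x v v'
  proof -
    obtain k k' where k: "k < length As" "(x - slot k, v) \<in> set (As ! k)"
      and k': "k' < length As" "(x - slot k', v') \<in> set (As ! k')"
      using vals unfolding val_def by blast
    then have "k = k'"
      using separated_disjoint[OF sep, of k k' 0] cell by blast
    then show ?thesis
      using k k' separatedD(1)[OF sep k(1)] by (metis eq_key_imp_eq_value)
  qed
  have "holds c (slot k + 0) (As ! k)" if "k < length As" for k
    unfolding holds_def
  proof
    fix z assume "z \<in> set (As ! k)"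
    then have "val (fst z + slot k) (snd z)"
      unfolding val_def using that by (metis add_diff_cancel_right' prod.collapse)
    moreover have "fst z + slot k \<in> band_cells 0 As"
      using \<open>z \<in> _\<close> that unfolding band_cells_def cells_def by auto
    ultimately have "c (fst z + slot k) = snd z"
      unfolding c_def by (auto intro: uniq someI)
    then show "case z of (x, v) \<Rightarrow> c (x + (slot k + 0)) = v"
      by (simp add: case_prod_unfold)
  qed
  then have "band c 0 As"
    unfolding band_def by blast
  moreover have "c x < n" for x
  proof (cases "x \<in> band_cells 0 As")
    case True
    then have "val x (c x)"
      unfolding c_def using someI_ex[OF ex[OF True]] by simp
    then show ?thesis
      unfolding val_def using small by (metis nth_mem image_eqI list.set_map snd_conv)
  qed (simp add: c_def \<open>0 < n\<close>)
  ultimately show ?thesis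
    unfolding c_def by auto
qed

lemma finite_band_cells: "finite (band_cells d As)"
  by (simp add: band_cells_def cells_def)

lemma settled_config:
  assumes fits: "fits (length w) b h l PL U PR" and "w \<noteq> []" "q \<in> dirs"
  shows "\<exists>c. finite_config w (c, p, q) \<and> settled h l c 0 (framed PL U n PR)"
proof -
  let ?As = "framed PL U n PR"
  have "v < length w" if "A \<in> set ?As" "v \<in> set (map snd A)" for A v
    using that fits by (auto simp: framed_def fits_def split: if_splits)
  then obtain c where c: "band c 0 ?As" "\<forall>x. x \<notin> band_cells 0 ?As \<longrightarrow> c x = 0"
      "\<forall>x. c x < length w"
    using band_exists[OF fits_separated[OF fits], of n "length w"] \<open>w \<noteq> []\<close> by blast
  have "c (x + 0) = 0" if "snd x > h \<or> fst x < l" for x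
  proof -
    have "x + 0 \<notin> band_cells 0 ?As"
      using band_cells_framed(1,2)[OF fits, of x 0 n] that by (meson leD)
    then show ?thesis
      using c(2) by blast
  qed
  then have "settled h l c 0 ?As"
    using c(1) unfolding settled_def by blast
  moreover have "finite {x. c x \<noteq> 0}"
    using finite_subset[OF _ finite_band_cells[of 0 ?As]] c(2) by (metis (mono_tags, lifting) mem_Collect_eq subsetI)
  ultimately show ?thesis
    using c(3) \<open>q \<in> dirs\<close> unfolding finite_config_def prod.case by blast
qed

section \<open>Highways\<close>

text \<open>The letters read determine all turns, hence the trajectory up to its starting
  point.\<close>

lemma traj_of_trace:
  assumes "\<And>i. ant_trace w C i = ant_trace w D i" "snd (snd C) = snd (snd D)"
  shows "ant_traj w C i = ant_traj w D i + (fst (snd C) - fst (snd D))"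
  using assms
proof (induction i arbitrary: C D)
  case 0
  then show ?case by (simp add: ant_traj_0)
next
  case (Suc i)
  obtain c p q c' p' where CD: "C = (c, p, q)" "D = (c', p', q)"
    using Suc.prems(2) by (metis prod.collapse snd_conv)
  have "c p = c' p'"
    using Suc.prems(1)[of 0] by (simp add: CD ant_trace_0)
  then have "snd (snd (ant_step w C)) = snd (snd (ant_step w D))"
    and "fst (snd (ant_step w C)) - fst (snd (ant_step w D)) = p - p'"
    by (simp_all add: CD ant_step_eq)
  moreover have "ant_trace w (ant_step w C) i = ant_trace w (ant_step w D) i" for i
    using Suc.prems(1)[of "Suc i"] by (simp add: ant_trace_Suc)
  ultimately show ?case
    using Suc.IH[of "ant_step w C" "ant_step w D"] by (simp add: ant_traj_Suc CD)
qed

text \<open>From any state in \<open>P\<close> the ant reads \<open>ts\<close> and is in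
  \<open>P\<close> again, so all states in \<open>P\<close> have the same trace. Comparing
  \<open>C\<close> with its successor gives the period, and \<open>traj_of_trace\<close> the
  drift.\<close>

lemma highway_condI:
  assumes step: "\<And>C. P C \<Longrightarrow> \<exists>S C'. reads w S C ts C' \<and> P C' \<and>
      snd (snd C') = snd (snd C) \<and> fst (snd C') = fst (snd C) + (a, b)"
    and "ts \<noteq> []" "P C"
  shows "highway_cond w C (length ts) a b"
proof -
  have trace: "ant_trace w C i = ant_trace w D i" if "P C" "P D" for C D i
    using that
  proof (induction i arbitrary: C D rule: less_induct)
    case (less i)
    obtain S C' where C': "reads w S C ts C'" "P C'"
      using step[OF less.prems(1)] by blast
    obtain T D' where D': "reads w T D ts D'" "P D'"
      using step[OF less.prems(2)] by blast
    show ?case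
    proof (cases "i < length ts")
      case True
      then show ?thesis
        using reads_trace_traj[OF C'(1)] reads_trace_traj[OF D'(1)] by metis
    next
      case False
      then have "ant_trace w C i = ant_trace w C' (i - length ts)"
          "ant_trace w D i = ant_trace w D' (i - length ts)"
        using ant_trace_add[of w C "length ts" "i - length ts"] reads_funpow[OF C'(1)]
          ant_trace_add[of w D "length ts" "i - length ts"] reads_funpow[OF D'(1)]
        by simp_all
      moreover have "i - length ts < i"
        using False \<open>ts \<noteq> []\<close> by (cases ts) auto
      ultimately show ?thesis
        using less.IH C'(2) D'(2) by metis
    qed
  qed
  obtain S C' where C': "reads w S C ts C'" "P C'"
      "snd (snd C') = snd (snd C)" "fst (snd C') = fst (snd C) + (a, b)"
    using step[OF \<open>P C\<close>] by blast
  have "ant_trace w C (i + length ts) = ant_trace w C i" for i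
    using ant_trace_add[of w C "length ts" i] reads_funpow[OF C'(1)] trace[OF C'(2) \<open>P C\<close>]
    by (simp add: add.commute)
  moreover have "ant_traj w C (i + length ts) = ant_traj w C i + (a, b)" for i
    using ant_traj_add[of w C "length ts" i] reads_funpow[OF C'(1)]
      traj_of_trace[OF trace[OF C'(2) \<open>P C\<close>] C'(3), of i] C'(4)
    by (simp add: add.commute)
  ultimately show ?thesis
    by (simp add: highway_cond_def plus_prod_def)
qed

lemma highway_traj:
  assumes "highway_cond w C n a b"
  shows "ant_traj w C (i + k * n) = ant_traj w C i + (int k * a, int k * b)"
proof (induction k)
  case (Suc k)
  have "ant_traj w C (i + Suc k * n) = ant_traj w C ((i + k * n) + n)"
    by (simp add: algebra_simps)
  also have "\<dots> = ant_traj w C (i + k * n) + (a, b)"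
    using assms unfolding highway_cond_def plus_prod_def by (metis fst_conv snd_conv)
  finally show ?case
    by (simp add: Suc algebra_simps)
qed (simp flip: zero_prod_def)

text \<open>After \<open>n * n'\<close> steps, a multiple of both periods, the two displacements
  must agree. For \<open>C' = C\<close> this relates two periods of the same highway.\<close>

lemma highway_equiv_drift:
  assumes C: "highway_cond w C n a b" and C': "highway_cond w C' n' a' b'"
    and "highway_equiv w C C'"
  shows "int n' * a = int n * a'" "int n' * b = int n * b'"
proof -
  obtain k k' v where eq: "\<And>i. ant_traj w C (k + i) = ant_traj w C' (k' + i) + v"
  proof -
    obtain k k' v1 v2 where "\<forall>i. ant_traj w C (k + i) =
        (fst (ant_traj w C' (k' + i)) + v1, snd (ant_traj w C' (k' + i)) + v2)"
      using assms(3) unfolding highway_equiv_def by blast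
    then show ?thesis
      using that[of k k' "(v1, v2)"] by (simp add: plus_prod_def)
  qed
  have "ant_traj w C k + (int n' * a, int n' * b) = ant_traj w C (k + n' * n)"
    by (simp add: highway_traj[OF C])
  also have "\<dots> = ant_traj w C' (k' + n * n') + v"
    by (simp add: eq mult.commute)
  also have "\<dots> = ant_traj w C k + (int n * a', int n * b')"
    using eq[of 0] by (simp add: highway_traj[OF C'])
  finally show "int n' * a = int n * a'" "int n' * b = int n * b'"
    by simp_all
qed

lemma highway_equiv_refl: "highway_equiv w C C"
  unfolding highway_equiv_def
  by (rule exI[of _ 0], rule exI[of _ 0], rule exI[of _ 0], rule exI[of _ 0]) simp

text \<open>The known period need not be minimal. The drift of the least period is proportional to
  the known one, hence also diagonal.\<close>

lemma diagonal_highwayI: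
  assumes C: "highway_cond w C n a b" and "0 < n" "\<bar>a\<bar> = \<bar>b\<bar>" "finite_config w C"
  shows "diagonal_highway_from w C"
proof -
  let ?P = "\<lambda>n. 0 < n \<and> (\<exists>a b. highway_cond w C n a b)"
  define m where "m = (LEAST n. ?P n)"
  have "?P m"
    unfolding m_def by (rule LeastI[of ?P n]) (use assms in blast)
  then obtain a' b' where m: "0 < m" "highway_cond w C m a' b'"
    by blast
  have minimal: "\<not> highway_cond w C k x y" if "0 < k \<and> k < m" for k x y
    using not_less_Least[of k ?P] that unfolding m_def by blast
  have "int n * \<bar>a'\<bar> = int n * \<bar>b'\<bar>"
    using highway_equiv_drift[OF m(2) C highway_equiv_refl] \<open>\<bar>a\<bar> = \<bar>b\<bar>\<close>
    by (metis abs_mult abs_of_nat)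
  then have "\<bar>a'\<bar> = \<bar>b'\<bar>"
    using \<open>0 < n\<close> by simp
  then show ?thesis
    unfolding diagonal_highway_from_def in_highway_def
    using m minimal \<open>finite_config w C\<close> by blast
qed

lemma certified_highway:
  assumes cert: "certificate w h l ls wE PL U PR PR 0 p q"
    and fits: "fits v b h l PL U PR" and "1 \<le> m" "interleave (laps_pairs ls wE) m \<noteq> []"
    and "settled h l c d (framed PL U (Suc m) PR)"
  shows "highway_cond w (c, p + d, q) (length (interleave (laps_pairs ls wE) m)) (-2) 2"
proof (rule highway_condI)
  let ?P = "\<lambda>C. \<exists>c d. C = (c, p + d, q) \<and> settled h l c d (framed PL U (Suc m) PR)"
  show "?P (c, p + d, q)"
    using assms(5) by blast
  show "\<exists>S C'. reads w S C (interleave (laps_pairs ls wE) m) C' \<and> ?P C' \<and>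
      snd (snd C') = snd (snd C) \<and> fst (snd C') = fst (snd C) + (-2, 2)" if "?P C" for C
  proof -
    obtain c d where C: "C = (c, p + d, q)" "settled h l c d (framed PL U (Suc m) PR)"
      using \<open>?P C\<close> by blast
    obtain c' where "reads w (band_cells d (framed PL U (Suc m) PR)) C
        (interleave (laps_pairs ls wE) m) (c', p + ((-2, 2) + d), q)"
        "settled h l c' ((-2, 2) + d) (framed PL U (Suc m) PR)"
      using certificate_step[OF cert fits _ \<open>1 \<le> m\<close> C(2)] unfolding C(1) by auto
    moreover have "p + ((-2, 2) + d) = p + d + (-2, 2)"
      by (simp add: ac_simps)
    ultimately show ?thesis
      unfolding C(1) by (intro exI conjI) (assumption | simp)+
  qed
qed fact

section \<open>Cones\<close>

text \<open>The offset \<open>e\<close> comes from the finite computation at the left end, so a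
  single \<open>e\<close> serves all \<open>m\<close>, \<open>c\<close>, \<open>d\<close> and
  \<open>j\<close>.\<close>

lemma certificate_sweep:
  assumes cert: "certificate w h l ((wL, vR, wR, vL) # ls) wE PL U PR PR' \<delta> p q"
    and fits: "fits v b h l PL U PR"
  shows "\<exists>e. \<forall>m c d j. j \<le> m \<longrightarrow> band c d (framed PL U (Suc m) PR) \<longrightarrow>
    ant_traj w (c, p + d, q) (length wL + j * length vR) = e + slot j + d"
proof -
  have "lap w (wL, vR, wR, vL) (PL, U, U, PR, p, q) \<noteq> None"
    using cert by (rule contrapos_pn) (simp add: certificate_def del: lap.simps)
  then obtain PL1 H1 U1 PR1 p1 q1 where
    lap: "lap w (wL, vR, wR, vL) (PL, U, U, PR, p, q) = Some (PL1, H1, U1, PR1, p1, q1)"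
    by (metis option.exhaust prod_cases6)
  obtain H e q' V where adv: "advance w wL PL U p q = Some (PL1, H, e, q')"
    "advance w vR H U (e - (2, 0)) q' = Some (V, H, e, q')"
    using lap by (rule lapE) blast
  have "ant_traj w (c, p + d, q) (length wL + j * length vR) = e + slot j + d"
    if "j \<le> m" "band c d (framed PL U (Suc m) PR)" for m c d j
    using sweep_position[OF adv, of m PR c d j] fits_separated[OF fits, of "Suc m"] that
    by (simp add: framed_def)
  then show ?thesis
    by blast
qed

section \<open>Interleaved words and runs composed of blocks\<close>

lemma interleave_append: "interleave (ps @ qs) n = interleave ps n @ interleave qs n"
  by (simp add: interleave_def)

lemma concat_replicate_concat:
  "concat (replicate n (concat (replicate b v))) = concat (replicate (b * n) v)"
  by (induction n) (simp_all add: replicate_add)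

text \<open>The power \<open>a + b * n\<close> of \<open>v\<close> is its power \<open>a\<close>,
  absorbed into the fixed word, followed by the \<open>n\<close>-th power of \<open>v\<close>
  repeated \<open>b\<close> times.\<close>

lemma interleave_affine:
  "interleave ps (a + b * n) =
   interleave (map (\<lambda>(u, v). (u @ concat (replicate a v), concat (replicate b v))) ps) n"
  by (induction ps) (auto simp: interleave_def concat_replicate_concat replicate_add)

lemma interlace_block_interleave:
  "interlace_block (length ps) (\<lambda>i. fst (ps ! i)) (\<lambda>i. snd (ps ! i)) n = interleave ps n"
proof -
  have "map (\<lambda>i. fst (ps ! i) @ concat (replicate n (snd (ps ! i)))) [0..<length ps]
      = map (\<lambda>(u, v). u @ concat (replicate n v)) ps"
    by (rule nth_equalityI) (simp_all add: case_prod_unfold)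
  then show ?thesis
    by (simp add: interlace_block_def interleave_def)
qed

lemma reads_blocks:
  assumes step: "\<And>n C. Q n C \<Longrightarrow> \<exists>C'. reads w (S n) C (t n) C' \<and> Q (Suc n) C'"
    and "Q 0 C"
  defines "T \<equiv> \<lambda>n. \<Sum>l<n. length (t l)"
  shows "Q n ((ant_step w ^^ T n) C)"
    and "j < length (t n) \<Longrightarrow> ant_trace w C (T n + j) = t n ! j \<and> ant_traj w C (T n + j) \<in> S n"
proof -
  show Q: "Q n ((ant_step w ^^ T n) C)" for n
  proof (induction n)
    case (Suc n)
    obtain C' where C': "reads w (S n) ((ant_step w ^^ T n) C) (t n) C'" "Q (Suc n) C'"
      using step[OF Suc] by blast
    have "T (Suc n) = length (t n) + T n"
      by (simp add: T_def)
    then have "(ant_step w ^^ T (Suc n)) C = C'"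
      using reads_funpow[OF C'(1)] by (simp add: funpow_add)
    then show ?case
      using C'(2) by simp
  qed (simp add: T_def \<open>Q 0 C\<close>)
  show "j < length (t n) \<Longrightarrow> ant_trace w C (T n + j) = t n ! j \<and> ant_traj w C (T n + j) \<in> S n"
    using step[OF Q[of n]] reads_trace_traj by (metis ant_trace_add ant_traj_add)
qed

section \<open>Segments in the plane and cone behaviour\<close>

lemma dist_le_sum_abs: "dist (x, y) (x', y') \<le> \<bar>x - x'\<bar> + \<bar>y - y'\<bar>" for x y x' y' :: real
  by (simp add: dist_Pair_Pair dist_real_def sqrt_sum_squares_le_sum_abs)

lemma dil_trans_segment:
  "dil_trans r s d (closed_segment a b) = closed_segment (r *\<^sub>R a + s *\<^sub>R d) (r *\<^sub>R b + s *\<^sub>R d)"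
  by (auto simp: dil_trans_def closed_segment_image_interval image_image algebra_simps
      intro!: image_cong)

lemma frontier_segment: "frontier (closed_segment a b) = closed_segment a b" for a b :: "real \<times> real"
  by (simp add: frontier_def interior_closed_segment_ge2)

text \<open>Both \<open>f\<close> and \<open>g\<close> are the index of the current block, so
  \<open>g \<in> \<Theta>(f)\<close> is immediate. A segment is its own frontier in the plane;
  \<open>near\<close> keeps the ant close to it, and \<open>sweep\<close> visits it at spacing 2 in
  every block.\<close>

lemma cone_behaviourI:
  fixes C :: ant_conf and ps :: "(nat list \<times> nat list) list" and K :: int and e :: cell
  defines "t \<equiv> interleave ps"
  defines "T \<equiv> \<lambda>n. \<Sum>l<n. length (t l)"
  assumes "ps \<noteq> []" and nonempty: "\<And>n. t n \<noteq> []"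
    and trace: "\<And>n j. j < length (t n) \<Longrightarrow> ant_trace w C (T n + j) = t n ! j"
    and near: "\<And>n j x y. j < length (t n) \<Longrightarrow> ant_traj w C (T n + j) = (x, y) \<Longrightarrow>
      - 6 * int n - K \<le> x \<and> x \<le> - 2 * int n + K \<and> \<bar>y - 6 * int n\<bar> \<le> K"
    and sweep: "\<And>n i. i \<le> 2 * n \<Longrightarrow>
      \<exists>j < length (t n). ant_traj w C (T n + j) = e + (2 * int i - 6 * int n, 6 * int n)"
  shows "cone_behaviour_from w C"
proof -
  have T_Suc: "T (Suc n) = T n + length (t n)" for n
    by (simp add: T_def)
  have T_less: "T n < T (Suc n)" for n
    using nonempty[of n] by (simp add: T_Suc)
  then have T_strict: "strict_mono T"
    by (simp add: strict_mono_Suc_iff)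
  have "inf_concat t (ant_trace w C)"
    unfolding inf_concat_def using nonempty trace by (auto simp: T_def)
  then have "inf_concat (interlace_block (length ps) (\<lambda>i. fst (ps ! i)) (\<lambda>i. snd (ps ! i)))
      (ant_trace w C)"
    by (simp add: t_def interlace_block_interleave[abs_def])
  then have "interlaced (ant_trace w C)"
    unfolding interlaced_def using \<open>ps \<noteq> []\<close> by (metis One_nat_def Suc_leI length_greater_0_conv)
  then have inter: "eventually_interlaced (ant_trace w C)"
    unfolding eventually_interlaced_def by (intro exI[of _ 0]) simp

  define idx where "idx i = (LEAST n. i < T (Suc n))" for i
  have idx1: "i < T (Suc (idx i))" for i
  proof -
    have "i < T (Suc i)"
      using strict_mono_imp_increasing[OF T_strict, of "Suc i"] by simp
    then show ?thesis
      unfolding idx_def by (rule LeastI)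
  qed
  have idx2: "T (idx i) \<le> i" for i
  proof (cases "idx i")
    case (Suc n)
    then have "\<not> i < T (Suc n)"
      unfolding idx_def by (intro not_less_Least) simp
    then show ?thesis
      using Suc by simp
  qed (simp add: T_def)
  have idx_ge: "n \<le> idx i" if "T n \<le> i" for n i
  proof -
    have "T n < T (Suc (idx i))"
      using that idx1[of i] by simp
    then show ?thesis
      using T_strict by (simp add: strict_mono_less)
  qed
  have idx_eq: "idx (T n + j) = n" if "j < length (t n)" for n j
  proof -
    have "idx (T n + j) \<le> n"
      unfolding idx_def by (rule Least_le) (simp add: T_Suc that)
    then show ?thesis
      using idx_ge[of n "T n + j"] by simp
  qed
  have split: "\<exists>j < length (t (idx i)). i = T (idx i) + j" for i
    using idx1[of i] idx2[of i] by (intro exI[of _ "i - T (idx i)"]) (auto simp: T_Suc)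

  define f where "f i = real (idx i)" for i
  define \<Delta> where "\<Delta> = closed_segment (0 :: real \<times> real) (4, 0)"
  define d where "d = (-6 :: real, 6 :: real)"
  \<comment> \<open>Twice \<open>\<bar>K\<bar>\<close> covers the two coordinates in
    \<open>near\<close>; the offset \<open>e\<close> and the spacing 2 account for the approximation
    of frontier points.\<close>
  define k where "k = 2 * \<bar>K\<bar> + \<bar>fst e\<bar> + \<bar>snd e\<bar> + 2"
  let ?y = "\<lambda>n. to_real2 (ant_traj w C n)"
  have nonneg: "0 \<le> f i" for i
    by (simp add: f_def)
  have d: "d \<noteq> 0"
    by (simp add: d_def zero_prod_def)
  have "mono f"
  proof (rule monoI)
    fix i j :: nat assume "i \<le> j"
    then have "T (idx i) \<le> j"
      using idx2[of i] by simp
    then show "f i \<le> f j"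
      using idx_ge by (simp add: f_def)
  qed
  moreover have "?y i \<in> bdry_nbhd (real_of_int k) (dil_trans (f i) (f i) d \<Delta>)" for i
  proof -
    define n where "n = real (idx i)"
    obtain x y where xy: "ant_traj w C i = (x, y)"
      by (metis prod.collapse)
    have "- 6 * int (idx i) - K \<le> x \<and> x \<le> - 2 * int (idx i) + K \<and> \<bar>y - 6 * int (idx i)\<bar> \<le> K"
      using split[of i] near xy by metis
    then have b: "- 6 * n - K \<le> x" "x \<le> - 2 * n + K" "\<bar>y - 6 * n\<bar> \<le> K"
      unfolding n_def by linarith+
    \<comment> \<open>The abscissa \<open>x\<close> is clamped to the range of the segment.\<close>
    define u where "u = max (- 6 * n) (min (- 2 * n) (real_of_int x))"
    have n: "0 \<le> n"
      by (simp add: n_def)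
    have u: "- 6 * n \<le> u" "u \<le> - 2 * n" "\<bar>x - u\<bar> \<le> \<bar>K\<bar>"
      using b n unfolding u_def by linarith+
    have seg: "dil_trans (f i) (f i) d \<Delta> = closed_segment (- 6 * n, 6 * n) (- 2 * n, 6 * n)"
      unfolding \<Delta>_def dil_trans_segment by (simp add: d_def f_def n_def mult.commute)
    have "(u, 6 * n) \<in> closed_segment (- 6 * n, 6 * n) (- 2 * n, 6 * n)"
    proof (cases "n = 0")
      case True
      then show ?thesis using u by simp
    next
      case False
      define s where "s = (u + 6 * n) / (4 * n)"
      have s: "4 * n * s = u + 6 * n"
        using False by (simp add: s_def)
      have "0 \<le> s" "s \<le> 1"
        using u n False by (simp_all add: s_def field_simps)
      moreover have "(u, 6 * n) = (1 - s) *\<^sub>R (- 6 * n, 6 * n) + s *\<^sub>R (- 2 * n, 6 * n)"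
        using s by (simp add: algebra_simps)
      ultimately show ?thesis
        unfolding in_segment by blast
    qed
    moreover have "dist (?y i) (u, 6 * n) \<le> real_of_int k"
    proof -
      have "dist (?y i) (u, 6 * n) \<le> \<bar>x - u\<bar> + \<bar>y - 6 * n\<bar>"
        using dist_le_sum_abs by (simp add: to_real2_def xy)
      also have "\<dots> \<le> real_of_int k"
        using u(3) b(3) unfolding k_def by simp
      finally show ?thesis .
    qed
    ultimately show ?thesis
      unfolding bdry_nbhd_def seg frontier_segment by blast
  qed
  moreover have "\<exists>i\<ge>N. dist (?y i) (f i *\<^sub>R p + f i *\<^sub>R d) \<le> real_of_int k"
    if p: "p \<in> frontier \<Delta>" for p N
  proof -
    obtain s where s: "0 \<le> s" "s \<le> 1" "p = (4 * s, 0)"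
      using p unfolding \<Delta>_def frontier_segment in_segment by auto
    \<comment> \<open>The dilated point has abscissa \<open>4 * s * N\<close> from the left end of
      the segment; \<open>i\<close> is the last visited position, at spacing 2, not beyond
      it.\<close>
    define i where "i = nat \<lfloor>2 * s * real N\<rfloor>"
    have i: "real i \<le> 2 * s * real N" "2 * s * real N < real i + 1"
      using s unfolding i_def by (simp_all add: of_nat_nat)
    have "2 * s * real N \<le> 2 * real N"
      using s by (simp add: mult_left_le_one_le)
    then have "i \<le> 2 * N"
      using i(1) by linarith
    then obtain j where j: "j < length (t N)"
        "ant_traj w C (T N + j) = e + (2 * int i - 6 * int N, 6 * int N)"
      using sweep by blast
    have "N \<le> T N"
      using strict_mono_imp_increasing[OF T_strict] .
    moreover have "dist (?y (T N + j)) (f (T N + j) *\<^sub>R p + f (T N + j) *\<^sub>R d) \<le> real_of_int k"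
    proof -
      have "?y (T N + j) = (fst e + (2 * real i - 6 * real N), snd e + 6 * real N)"
        by (simp add: to_real2_def j(2))
      moreover have "f (T N + j) *\<^sub>R p + f (T N + j) *\<^sub>R d
          = (real N * (4 * s) - 6 * real N, 6 * real N)"
        by (simp add: f_def idx_eq[OF j(1)] s(3) d_def)
      ultimately have "dist (?y (T N + j)) (f (T N + j) *\<^sub>R p + f (T N + j) *\<^sub>R d)
          \<le> \<bar>fst e + (2 * real i - 6 * real N) - (real N * (4 * s) - 6 * real N)\<bar> +
            \<bar>snd e + 6 * real N - 6 * real N\<bar>"
        by (simp only: dist_le_sum_abs)
      also have "\<dots> \<le> real_of_int k"
        using i unfolding k_def by (simp add: algebra_simps)
      finally show ?thesis .
    qed
    ultimately show ?thesis
      by (intro exI[of _ "T N + j"]) simp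
  qed
  ultimately have "previsible_with \<Delta> ?y f f k d"
    unfolding previsible_with_def using nonneg d by blast
  moreover have "filterlim f at_top sequentially"
    unfolding filterlim_at_top
  proof
    fix Z :: real
    obtain n :: nat where "Z \<le> real n"
      using real_arch_simple by blast
    then have "Z \<le> f i" if "T n \<le> i" for i
      using idx_ge[OF that] by (simp add: f_def)
    then show "\<forall>\<^sub>F i in sequentially. Z \<le> f i"
      by (auto simp: eventually_sequentially)
  qed
  moreover have "compact \<Delta>" "0 \<in> \<Delta>"
    by (simp_all add: \<Delta>_def)
  moreover have "f \<in> \<Theta>(f)"
    by simp
  ultimately show ?thesis
    unfolding cone_behaviour_from_def using inter by blast
qed

section \<open>The patches and words for LLRLRLL\<close>

text \<open>
The following pictures and words were read off simulations of the ant. A picture is given by its top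
left cell and its rows; the entry \<open>7\<close> leaves a cell unconstrained.
\<close>

fun picture_row :: "cell \<Rightarrow> nat list \<Rightarrow> patch" where
  "picture_row p [] = []"
| "picture_row p (v # vs) = (if v < 7 then [(p, v)] else []) @ picture_row (p + (1, 0)) vs"

fun picture :: "cell \<Rightarrow> nat list list \<Rightarrow> patch" where
  "picture p [] = []"
| "picture p (r # rs) = picture_row p r @ picture (p - (0, 1)) rs"

definition left_end :: patch where
  "left_end = picture (-7, 4)
    [[0,0,0,0,0,0,0,0,0],
     [0,0,0,0,0,0,0,0,0],
     [0,0,0,0,0,0,0,0,0],
     [0,0,0,0,0,0,0,0,0],
     [0,0,1,1,1,2,2,2,2],
     [0,0,3,3,3,4,4,5,6],
     [0,0,2,5,4,4,4,5,7],
     [0,0,2,4,5,5,5,7,7],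
     [0,0,3,5,7,7,7,7,7]]"

definition front :: patch where
  "front = picture (0, 4)
    [[0,0],
     [0,0],
     [0,0],
     [0,0],
     [2,2],
     [6,6]]"

definition cone_end0 :: patch where
  "cone_end0 = picture (0, 4)
    [[0,0,0,0,0,7,7],
     [0,0,0,0,7,7,7],
     [0,0,0,0,0,0,7],
     [0,0,0,0,0,0,7],
     [2,2,2,2,0,7,7],
     [6,6,6,2,0,0,0],
     [1,1,6,2,2,2,0],
     [1,1,1,1,6,2,7],
     [7,1,5,5,6,2,7],
     [7,7,7,7,6,6,7]]"

definition cone_end1 :: patch where
  "cone_end1 = picture (0, 4)
    [[0,0,0,0,0,7,7,7],
     [0,0,0,0,0,0,0,7],
     [0,0,0,0,0,0,0,7],
     [0,0,0,0,0,0,7,7],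
     [2,2,2,2,0,0,0,0],
     [6,6,6,2,0,2,2,0],
     [7,1,1,6,6,6,2,7],
     [7,7,1,5,5,6,2,7],
     [7,7,7,7,7,6,6,7]]"

definition cone_end2 :: patch where
  "cone_end2 = picture (0, 4)
    [[0,0,0,0,0,0,7],
     [0,0,0,0,0,0,7],
     [0,0,0,0,0,7,7],
     [0,0,0,0,0,0,0],
     [2,2,0,0,2,2,0],
     [6,6,6,6,6,2,7],
     [7,1,5,5,6,2,7],
     [7,7,7,7,6,6,7]]"

definition highway_end :: patch where
  "highway_end = picture (0, 4)
    [[0,0,0,0,0,0,0,0,0,0,7,7],
     [0,0,0,0,0,0,0,0,0,0,7,7],
     [0,0,2,2,1,1,2,2,2,2,2,7],
     [0,0,2,5,3,3,5,6,6,5,5,2],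
     [2,2,2,4,5,4,6,2,1,2,1,4],
     [6,6,6,4,4,5,6,2,5,5,3,1],
     [7,7,7,0,5,7,7,0,5,7,7,7]]"

definition left_word1 :: "nat list" where
  "left_word1 =
     [0,0,3,1,1,1,4,2,0,0,2,3,5,4,5,4,4,5,5,4,5,5,4,2,2,6,6,2]"

definition left_word2 :: "nat list" where
  "left_word2 =
     [1,4,3,0,0,5,4,0,0,3,5,1,1,4,3,0,0,5,4,0,0,3,5,1,1,4,2,0,0,1,3,1,1,2,1,3,3,3,2,0,
      0,2,2,0,0,0,3,1,1,1,4,2,0,0,1,3,1,1,2,1,3,3,3,2,0,0,0,3,1,1,1,4,4,4,2,5,2,2,4,6,
      5,4,5,4,4,5,5,4,5,5,4,2,2,6,6,2,2,6]"

definition left_word3 :: "nat list" where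
  "left_word3 =
     [4,0,0,3,5,1,1,4,3,0,0,5,4,0,0,3,5,1,1,4,3,0,0,5,4,0,0,3,5,1,1,4,2,0,0,1,3,1,1,2,
      1,3,3,3,2,0,0,2,2,0]"

definition cone0_word1 :: "nat list" where
  "cone0_word1 =
     [2,6,6,2,2,6,6,2,2,6,2,2,6,1,1,3,0,2,1,1,5,3,2,1,1,1,3,2,1,0,0,3,2,4,4,4,3,1,1,5,
      4,5,2,5,6,6,3,6,0,0,4,4,2,1,2,2,1,6,6,3,2,2,3,2,0,0,0,3,1,1,1,4,3,3,4,4,3,0,0,5,
      4,4,5,5,4,0,3,5,5,1,4,2,0,0,0,3,1,1,1,4,3,2,2,3,3,0,3,4,4,3,5,5,5,4,4,5,4,0,0,3,
      5,1]"

definition cone0_word2 :: "nat list" where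
  "cone0_word2 =
     [6,2,2,6,6,2,0,0,0,3,1,1,1,4,3,0,0,5]"

definition cone1_word1 :: "nat list" where
  "cone1_word1 =
     [2,6,6,2,2,6,6,2,2,6,2,6,6,0,3,0,0,1,4,2,0,0,0,3,1,1,1,4,3,0,5,5,4,0,0,3,5,1,1,4,
      3,0,0,5,4,0,0,3,5,1]"

definition cone1_word2 :: "nat list" where
  "cone1_word2 =
     [6,2,2,6,6,2,2,6,6,2,2,6,2,2,6,1,1,3,0,2,1,1,5,3,2,1,1,1,3,2,1,0,0,3,2,4,4,4,3,1,
      1,5,4,5,2,5,6,6,3,6,0,0,4,4,2,1,2,2,1,6,6,3,2,2,3,2,0,0,0,3,1,1,1,4,3,3,4,4,3,0,
      0,5,4,4,5,5,4,0,3,5,5,1,4,2,0,0,0,3,1,1,1,4,3,2,2,3,3,0,3,4,4,3,5,5,5,4,4,5,4,0,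
      0,3,5,1,1,4,3,0,0,5]"

definition cone2_word1 :: "nat list" where
  "cone2_word1 =
     [2,6,6,2,2,6,6,2,0,0,0,3,1,1,1,4,3,0,0,5,4,0,0,3,5,1]"

definition cone2_word2 :: "nat list" where
  "cone2_word2 =
     [6,2,2,6,6,2,2,6,2,6,6,0,3,0,0,1,4,2,0,0,0,3,1,1,1,4,3,0,5,5,4,0,0,3,5,1,1,4,3,0,
      0,5]"

definition highway_word1 :: "nat list" where
  "highway_word1 =
     [2,6,6,2,2,6,6,2,2,6,4,0,5,4,5,4,6,5,3,5,0,6,4,1,1,3,5,2,2,0,6,2,2,6,5,2,2,5,2,4,
      1,3,1,5,2,6,6,2,1,5,5,3,2,0,0,2,1,6,2,0,5,6,3,1,6,0,4,3,2,1,6,6,3,2,1,3,3,3,2,4,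
      4,4,3,4,3,0,0,5,4,1,0,3,5,2,4,6,4,0,0,3,5,1,1,4,2,0,0,2,2,0,0,0,3,1,1,1,4,2,0,3,
      3,3,1,4,3,0,0,5,4,0,0,3,5,1]"

definition highway_word2 :: "nat list" where
  "highway_word2 =
     [6,2,2,6,6,2,2,6,4,0,5,4,5,4,0,5,3,5,1,6,4,1,1,3,5,2,2,0,6,2,1,0,0,3,2,0,6,1,3,1,
      0,2,0,0,0,3,1,1,1,4,4,1,1,4,3,1,0,5,4,0,0,3,5,1,1,4,2,0,0,2,2,0,0,0,3,1,1,1,4,2,
      0,3,3,3,1,4,3,0,0,5]"

abbreviation (input) LLRLRLL :: "turn list" where "LLRLRLL \<equiv> [L, L, R, L, R, L, L]"

text \<open>Only the two words read at the right end vary, so the left end and the units behave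
  alike in all four computations.\<close>

definition lap_list :: "nat list \<Rightarrow> nat list \<Rightarrow> lap_words list" where
  "lap_list r1 r2 =
    [(left_word1, [2,6,6,2], r1, [1,4,3,0,0,5,4,0,0,3,5,1]),
     (left_word2, [6,2,2,6], r2, [4,0,0,3,5,1,1,4,3,0,0,5])]"

text \<open>The number of units does not occur in a certificate, so evaluation decides it.\<close>

lemma highway_certificate:
  "certificate LLRLRLL 4 (-7) (lap_list highway_word1 highway_word2) left_word3
     left_end front highway_end highway_end 0 (-6, 0) (-1, 0)"
  by code_simp

text \<open>The three cone certificates form a cycle of right ends. The first period keeps the
  number of units and the other two add one each, while the origin moves by \<open>(-6, 6)\<close>
  in total.\<close>

lemma cone0_certificate:
  "certificate LLRLRLL 4 (-7) (lap_list cone0_word1 cone0_word2) left_word3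
     left_end front cone_end0 cone_end1 0 (-6, 0) (-1, 0)"
  by code_simp

lemma cone1_certificate:
  "certificate LLRLRLL 4 (-7) (lap_list cone1_word1 cone1_word2) left_word3
     left_end front cone_end1 cone_end2 1 (-6, 0) (-1, 0)"
  by code_simp

lemma cone2_certificate:
  "certificate LLRLRLL 4 (-7) (lap_list cone2_word1 cone2_word2) left_word3
     left_end front cone_end2 cone_end0 1 (-6, 0) (-1, 0)"
  by code_simp

text \<open>The bound \<open>11\<close> is the last column of \<open>highway_end\<close>;
  \<open>4\<close> is the top row of all patches and \<open>-7\<close> the leftmost column of
  \<open>left_end\<close>.\<close>

lemma highway_end_fits: "fits (length LLRLRLL) 11 4 (-7) left_end front highway_end"
  by code_simp

lemma cone_end0_fits: "fits (length LLRLRLL) 11 4 (-7) left_end front cone_end0"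
  by code_simp

lemma cone_end1_fits: "fits (length LLRLRLL) 11 4 (-7) left_end front cone_end1"
  by code_simp

lemma cone_end2_fits: "fits (length LLRLRLL) 11 4 (-7) left_end front cone_end2"
  by code_simp


section \<open>The highways and the cone of LLRLRLL\<close>

lemma length_interleave:
  "length (interleave ps n) =
     sum_list (map (length \<circ> fst) ps) + n * sum_list (map (length \<circ> snd) ps)"
  by (induction ps) (auto simp: interleave_def length_concat sum_list_replicate algebra_simps)

abbreviation highway_pairs :: "(nat list \<times> nat list) list" where
  "highway_pairs \<equiv> laps_pairs (lap_list highway_word1 highway_word2) left_word3"

lemma highways:
  "\<exists>S. infinite S \<and> (\<forall>C\<in>S. finite_config LLRLRLL C \<and> diagonal_highway_from LLRLRLL C) \<and>
     (\<forall>C\<in>S. \<forall>C'\<in>S. C \<noteq> C' \<longrightarrow> \<not> highway_equiv LLRLRLL C C')"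
proof -
  let ?len = "\<lambda>m. length (interleave highway_pairs (Suc m))"
  have "\<exists>C. finite_config LLRLRLL C \<and> highway_cond LLRLRLL C (?len m) (-2) 2" for m
  proof -
    obtain c where c: "finite_config LLRLRLL (c, (-6, 0), (-1, 0))"
        "settled 4 (-7) c 0 (framed left_end front (Suc (Suc m)) highway_end)"
      using settled_config[OF highway_end_fits, of "(-1, 0)" "(-6, 0)"]
      by (auto simp: dirs_def simp del: split_paired_Ex)
    have "interleave highway_pairs (Suc m) \<noteq> []"
      by (simp add: interleave_def laps_pairs_def lap_list_def left_word1_def)
    from certified_highway[OF highway_certificate highway_end_fits _ this c(2)]
    show ?thesis
      using c(1) by (metis add_0_right le_add1 plus_1_eq_Suc)
  qed
  then obtain C where C: "\<And>m. finite_config LLRLRLL (C m)"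
      "\<And>m. highway_cond LLRLRLL (C m) (?len m) (-2) 2"
    by metis
  have "sum_list (map (length \<circ> snd) highway_pairs) = 32"
    by (simp add: laps_pairs_def lap_list_def)
  then have len: "?len m = ?len m' \<longleftrightarrow> m = m'" for m m'
    by (simp add: length_interleave)
  have inequiv: "m = m'" if "highway_equiv LLRLRLL (C m) (C m')" for m m'
    \<comment> \<open>Both drifts have second coordinate 2, so equivalence forces equal periods;
      these grow by 32 per unit.\<close>
    using highway_equiv_drift(2)[OF C(2) C(2) that] len[of m m'] by simp
  have "inj C"
    by (rule injI) (metis inequiv highway_equiv_refl)
  then have "infinite (range C)"
    by (simp add: finite_image_iff)
  moreover have "diagonal_highway_from LLRLRLL (C m)" for m
    by (rule diagonal_highwayI[OF C(2)])
      (simp_all add: C(1) length_interleave laps_pairs_def lap_list_def)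
  ultimately show ?thesis
    using C(1) inequiv by (intro exI[of _ "range C"]) auto
qed

section \<open>The growing cycle of three periods\<close>

definition stretch :: "nat \<Rightarrow> ('a list \<times> 'a list) list \<Rightarrow> ('a list \<times> 'a list) list" where
  "stretch a ps = map (\<lambda>(u, v). (u @ concat (replicate a v), concat (replicate 2 v))) ps"

text \<open>The three periods of cycle \<open>n\<close> repeat their passing words
  \<open>2 * n + 1\<close>, \<open>2 * n + 1\<close> and \<open>2 * n + 2\<close> times. Stretching
  turns these into powers \<open>n\<close>, as an interlaced word requires.\<close>

definition cone_pairs :: "(nat list \<times> nat list) list" where
  "cone_pairs =
     stretch 1 (laps_pairs (lap_list cone0_word1 cone0_word2) left_word3) @
     stretch 1 (laps_pairs (lap_list cone1_word1 cone1_word2) left_word3) @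
     stretch 2 (laps_pairs (lap_list cone2_word1 cone2_word2) left_word3)"

lemma interleave_cone_pairs:
  "interleave cone_pairs n =
     interleave (laps_pairs (lap_list cone0_word1 cone0_word2) left_word3) (Suc (2 * n)) @
     interleave (laps_pairs (lap_list cone1_word1 cone1_word2) left_word3) (Suc (2 * n)) @
     interleave (laps_pairs (lap_list cone2_word1 cone2_word2) left_word3) (Suc (Suc (2 * n)))"
  unfolding cone_pairs_def stretch_def interleave_append interleave_affine[symmetric] by simp

text \<open>Of the \<open>2 * n + 2\<close> units, the first starts as the travelling patch
  \<open>H\<close>; this leaves \<open>2 * n + 1\<close> passes.\<close>

definition cone_state :: "nat \<Rightarrow> ant_conf \<Rightarrow> bool" where
  "cone_state n C \<longleftrightarrow> (\<exists>c. C = (c, (-6, 0) + (- 6 * int n, 6 * int n), (-1, 0)) \<and>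
     settled 4 (-7) c (- 6 * int n, 6 * int n)
       (framed left_end front (Suc (Suc (2 * n))) cone_end0))"

definition cone_region :: "nat \<Rightarrow> cell set" where
  "cone_region n = {(x, y). - 6 * int n - 30 \<le> x \<and> x \<le> - 2 * int n + 30 \<and> \<bar>y - 6 * int n\<bar> \<le> 30}"

text \<open>Within a cycle the origin is displaced by \<open>i\<close> equal to 0, 2 or 4. With the
  patch bound 11 and at most \<open>2 * n + 3\<close> units, the deviation is at most 19, within the
  margin 30.\<close>

lemma band_cells_region:
  assumes fits: "fits v 11 h l PL U PR" and "0 \<le> i" "i \<le> 4" "k \<le> 2 * n + 3"
  shows "band_cells (- 6 * int n - i, 6 * int n + i) (framed PL U k PR) \<subseteq> cone_region n"
proof
  let ?d = "(- 6 * int n - i, 6 * int n + i)"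
  fix z assume z: "z \<in> band_cells ?d (framed PL U k PR)"
  have "z - ?d + ?d \<in> band_cells ?d (framed PL U k PR)"
    using z by simp
  note bounds = band_cells_framed(3-5)[OF fits this]
  show "z \<in> cone_region n"
    using bounds assms(2-4) by (cases z) (auto simp: cone_region_def)
qed

lemma cone_state_step:
  assumes "cone_state n C"
  shows "\<exists>C'. reads LLRLRLL (cone_region n) C (interleave cone_pairs n) C' \<and> cone_state (Suc n) C'"
proof -
  let ?d = "\<lambda>i. (- 6 * int n - i, 6 * int n + i)"
  let ?p = "(-6, 0) :: cell" and ?q = "(-1, 0) :: dir"
  have d: "(-2, 2) + ?d 0 = ?d 2" "(-2, 2) + ?d 2 = ?d 4" "(-2, 2) + ?d 4 = ?d 6"
    by simp_all
  obtain c where C: "C = (c, ?p + ?d 0, ?q)"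
    and c: "settled 4 (-7) c (?d 0) (framed left_end front (Suc (Suc (2 * n))) cone_end0)"
    using assms by (auto simp: cone_state_def simp del: split_paired_Ex)
  obtain c1 where r1: "reads LLRLRLL
      (band_cells (?d 0) (framed left_end front (Suc (Suc (2 * n))) cone_end0))
      (c, ?p + ?d 0, ?q)
      (interleave (laps_pairs (lap_list cone0_word1 cone0_word2) left_word3) (Suc (2 * n)))
      (c1, ?p + ?d 2, ?q)"
    and c1: "settled 4 (-7) c1 (?d 2) (framed left_end front (Suc (Suc (2 * n))) cone_end1)"
    using certificate_step[OF cone0_certificate cone_end0_fits _ _ c] unfolding d by auto
  obtain c2 where r2: "reads LLRLRLL
      (band_cells (?d 2) (framed left_end front (Suc (Suc (2 * n))) cone_end1))
      (c1, ?p + ?d 2, ?q)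
      (interleave (laps_pairs (lap_list cone1_word1 cone1_word2) left_word3) (Suc (2 * n)))
      (c2, ?p + ?d 4, ?q)"
    and c2: "settled 4 (-7) c2 (?d 4) (framed left_end front (Suc (Suc (Suc (2 * n)))) cone_end2)"
    using certificate_step[OF cone1_certificate cone_end1_fits _ _ c1] unfolding d by auto
  obtain c3 where r3: "reads LLRLRLL
      (band_cells (?d 4) (framed left_end front (Suc (Suc (Suc (2 * n)))) cone_end2))
      (c2, ?p + ?d 4, ?q)
      (interleave (laps_pairs (lap_list cone2_word1 cone2_word2) left_word3) (Suc (Suc (2 * n))))
      (c3, ?p + ?d 6, ?q)"
    and c3: "settled 4 (-7) c3 (?d 6) (framed left_end front (Suc (Suc (Suc (Suc (2 * n))))) cone_end0)"
    using certificate_step[OF cone2_certificate cone_end2_fits _ _ c2] unfolding d by auto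
  have "reads LLRLRLL (cone_region n) C (interleave cone_pairs n) (c3, ?p + ?d 6, ?q)"
    unfolding interleave_cone_pairs reads_append C
    using reads_mono[OF r1 band_cells_region[OF cone_end0_fits]]
      reads_mono[OF r2 band_cells_region[OF cone_end1_fits]]
      reads_mono[OF r3 band_cells_region[OF cone_end2_fits]] by fastforce
  moreover have "?d 6 = (- 6 * int (Suc n), 6 * int (Suc n))"
      "Suc (Suc (Suc (Suc (2 * n)))) = Suc (Suc (2 * Suc n))"
    by simp_all
  then have "cone_state (Suc n) (c3, ?p + ?d 6, ?q)"
    using c3 unfolding cone_state_def by metis
  ultimately show ?thesis
    by blast
qed

lemma cone: "\<exists>C. finite_config LLRLRLL C \<and> cone_behaviour_from LLRLRLL C"
proof -
  let ?p = "(-6, 0) :: cell" and ?q = "(-1, 0) :: dir"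
  obtain c where fin: "finite_config LLRLRLL (c, ?p, ?q)"
    and c: "settled 4 (-7) c 0 (framed left_end front (Suc (Suc 0)) cone_end0)"
    using settled_config[OF cone_end0_fits, of ?q ?p] by (auto simp: dirs_def simp del: split_paired_Ex)
  let ?C = "(c, ?p, ?q)" and ?t = "interleave cone_pairs"
  let ?T = "\<lambda>n. \<Sum>l<n. length (?t l)"
  have state: "cone_state 0 ?C"
    using c by (simp add: cone_state_def zero_prod_def)
  have blocks: "cone_state n ((ant_step LLRLRLL ^^ ?T n) ?C)"
      "j < length (?t n) \<Longrightarrow>
        ant_trace LLRLRLL ?C (?T n + j) = ?t n ! j \<and> ant_traj LLRLRLL ?C (?T n + j) \<in> cone_region n"
    for n j
    using reads_blocks[of cone_state LLRLRLL cone_region ?t ?C] cone_state_step state by blast+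
  obtain e where e: "\<forall>m c d j. j \<le> m \<longrightarrow> band c d (framed left_end front (Suc m) cone_end0) \<longrightarrow>
      ant_traj LLRLRLL (c, ?p + d, ?q) (length left_word1 + j * length [2::nat,6,6,2]) = e + slot j + d"
    using certificate_sweep[OF cone0_certificate[unfolded lap_list_def] cone_end0_fits] by blast
  have "cone_behaviour_from LLRLRLL ?C"
  proof (rule cone_behaviourI)
    show "cone_pairs \<noteq> []"
      by (simp add: cone_pairs_def stretch_def laps_pairs_def)
    show "?t n \<noteq> []" for n
      unfolding interleave_cone_pairs
      by (simp add: interleave_def laps_pairs_def lap_list_def left_word1_def)
    show "ant_trace LLRLRLL ?C (?T n + j) = ?t n ! j" if "j < length (?t n)" for n j
      using blocks(2)[OF that] by blast
    show "- 6 * int n - 30 \<le> x \<and> x \<le> - 2 * int n + 30 \<and> \<bar>y - 6 * int n\<bar> \<le> 30"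
      if "j < length (?t n)" "ant_traj LLRLRLL ?C (?T n + j) = (x, y)" for n j x y
      using blocks(2)[OF that(1)] unfolding that(2) by (simp add: cone_region_def)
    show "\<exists>j<length (?t n). ant_traj LLRLRLL ?C (?T n + j) = e + (2 * int i - 6 * int n, 6 * int n)"
      if "i \<le> 2 * n" for n i
    proof (intro exI conjI)
      \<comment> \<open>The time is taken in the first sweep of cycle \<open>n\<close>, after
        \<open>i\<close> of its \<open>2 * n + 1\<close> passes.\<close>
      let ?j = "length left_word1 + i * length [2::nat,6,6,2]"
      have "length left_word1 + Suc (2 * n) * 4 \<le> length (?t n)"
        by (simp add: interleave_cone_pairs length_interleave laps_pairs_def lap_list_def)
      then show "?j < length (?t n)"
        using that by simp
      obtain c' where C': "(ant_step LLRLRLL ^^ ?T n) ?C = (c', ?p + (- 6 * int n, 6 * int n), ?q)"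
        and c': "band c' (- 6 * int n, 6 * int n) (framed left_end front (Suc (Suc (2 * n))) cone_end0)"
        using blocks(1)[of n] unfolding cone_state_def settled_def by blast
      have "ant_traj LLRLRLL ?C (?T n + ?j) = e + slot i + (- 6 * int n, 6 * int n)"
        unfolding ant_traj_add[of LLRLRLL ?C "?T n" ?j] C' using e c' that by (meson le_SucI)
      then show "ant_traj LLRLRLL ?C (?T n + ?j) = e + (2 * int i - 6 * int n, 6 * int n)"
        by (simp add: slot_def add.assoc)
    qed
  qed
  then show ?thesis
    using fin by blast
qed

theorem theorem2:
  shows "(\<exists>C. finite_config [L, L, R, L, R, L, L] C \<and>
              cone_behaviour_from [L, L, R, L, R, L, L] C) \<and>
         (\<exists>S :: ant_conf set. infinite S \<and>
            (\<forall>C\<in>S. finite_config [L, L, R, L, R, L, L] C \<and>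
                     diagonal_highway_from [L, L, R, L, R, L, L] C) \<and>
            (\<forall>C\<in>S. \<forall>C'\<in>S. C \<noteq> C' \<longrightarrow> \<not> highway_equiv [L, L, R, L, R, L, L] C C'))"
  using cone highways by (rule conjI)

end
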